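(* Let $\psi$ be a function, $p_0$ a point, $\Gamma$ a closed curve and $G$ a domain in the bicomplex space $\mathrm{B}$, and assume that they satisfy the following conditions: (a) $\psi$ is holomorphic in $G$. (b) $\Gamma$ is contained in $G$ and the difference $p-p_0$ is nonsingular for all $p\in\Gamma$. (c) There exists an orientable surface $S(\Gamma)$ contained in $G$ and bounded by the curve $\Gamma$ such that either (i) $p_0\notin S(\Gamma)$ and $v(\Gamma,p_0)=0$ hold, and $p-p_0$ is nonsingular for all $p\in S(\Gamma)$; or (ii) $p_0\in S(\Gamma)$ and $v(\Gamma,p_0)\ne 0$ hold, and $p-p_0$ is nonsingular for all $p\in S(\Gamma)\setminus\{p_0\}$. Then $$\psi(p_0)\odot v(\Gamma,p_0)=\frac{1}{2\pi j}\odot\int_\Gamma\frac{\psi(p)}{p-p_0}\odot dp .$$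
   Context: $\mathrm{B}=\mathbb{C}^2$ is the space of bicomplex numbers $p=(a,b)$, $a,b\in\mathbb{C}$, with componentwise addition and the commutative multiplication $(a,b)\odot(c,d)=(ac-bd,\ bc+ad)$; real $\lambda$ is identified with $(\lambda,0)$, and $j=(0,1)$. The norm is $\|(a,b)\|=\sqrt{|a|^2+|b|^2}$. A bicomplex number $(a,b)$ is singular if $a^2+b^2=0$, and nonsingular otherwise; a nonsingular $(a,b)$ has the inverse $\left(\frac{a}{a^2+b^2},\frac{-b}{a^2+b^2}\right)$, and $r/q=r\odot q^{-1}$ for nonsingular $q$. A domain is a connected open set. A bicomplex function $\psi$ (a function with arguments and values in $\mathrm{B}$) is holomorphic in $G$ if at every $p\in G$ the derivative $$\psi'(p)=\lim_{\Delta p\to 0,\ \Delta p\ \text{nonsingular}}\frac{\psi(p+\Delta p)-\psi(p)}{\Delta p}$$ exists (the limit being taken over nonsingular $\Delta p$ only). A curve $\Gamma$ in $\mathrm{B}$ is a piecewise continuously differentiable path $p(t)$, $r\le t\le s$, and the line integral is $\int_\Gamma\psi(p)\odot dp=\int_r^s\psi(p(t))\odot p'(t)\,dt$. The twining number of a closed curve $\Gamma$ with respect to $p_0$, where $p-p_0$ is nonsingular for all $p\in\Gamma$, is $$v(\Gamma,p_0)=\frac{1}{2\pi j}\odot\int_\Gamma\frac{dp}{p-p_0}.$$ $S(\Gamma)$ denotes a surface in $\mathrm{B}$ (regarded as $\mathbb{R}^4$) bounded by the closed curve $\Gamma$. *)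

theory Defs
  imports "HOL-Analysis.Analysis"
begin

section \<open>Bicomplex numbers\<close>

text \<open>
  The space is the product type, so that its addition, subtraction, zero, norm
  (the square root of the sum of the squared moduli) and real four-dimensional Euclidean
  structure are the library's. Only the multiplicative structure is added here.
\<close>

type_synonym bicomplex = "complex \<times> complex"

definition bic_times :: "bicomplex \<Rightarrow> bicomplex \<Rightarrow> bicomplex"  (infixl "\<odot>" 70) where
  "p \<odot> q = (fst p * fst q - snd p * snd q, snd p * fst q + fst p * snd q)"

definition bic_of_real :: "real \<Rightarrow> bicomplex" where
  "bic_of_real x = (complex_of_real x, 0)"

definition bic_j :: bicomplex where
  "bic_j = (0, 1)"

definition nonsingular :: "bicomplex \<Rightarrow> bool" where
  "nonsingular p \<longleftrightarrow> (fst p)\<^sup>2 + (snd p)\<^sup>2 \<noteq> 0"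

text \<open>Inverse and quotient are meaningful for nonsingular (divisor) arguments only.\<close>

definition bic_inverse :: "bicomplex \<Rightarrow> bicomplex" where
  "bic_inverse p =
     (fst p / ((fst p)\<^sup>2 + (snd p)\<^sup>2), - snd p / ((fst p)\<^sup>2 + (snd p)\<^sup>2))"

definition bic_divide :: "bicomplex \<Rightarrow> bicomplex \<Rightarrow> bicomplex"  (infixl "\<oslash>" 70) where
  "p \<oslash> q = p \<odot> bic_inverse q"


section \<open>Holomorphic functions, curves and line integrals\<close>

definition bic_domain :: "bicomplex set \<Rightarrow> bool" where
  "bic_domain G \<longleftrightarrow> open G \<and> connected G"

definition bic_holomorphic_on :: "(bicomplex \<Rightarrow> bicomplex) \<Rightarrow> bicomplex set \<Rightarrow> bool" where
  "bic_holomorphic_on \<psi> G \<longleftrightarrow>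
     (\<forall>p\<in>G. \<exists>D. ((\<lambda>d. (\<psi> (p + d) - \<psi> p) \<oslash> d) \<longlongrightarrow> D) (at 0 within {d. nonsingular d}))"

definition closed_curve :: "real \<Rightarrow> real \<Rightarrow> (real \<Rightarrow> bicomplex) \<Rightarrow> bool" where
  "closed_curve r s \<Gamma> \<longleftrightarrow> r \<le> s \<and> \<Gamma> piecewise_C1_differentiable_on {r..s} \<and> \<Gamma> r = \<Gamma> s"

definition bic_line_integral ::
    "real \<Rightarrow> real \<Rightarrow> (real \<Rightarrow> bicomplex) \<Rightarrow> (bicomplex \<Rightarrow> bicomplex) \<Rightarrow> bicomplex" where
  "bic_line_integral r s \<Gamma> \<psi> =
     integral {r..s} (\<lambda>t. \<psi> (\<Gamma> t) \<odot> vector_derivative \<Gamma> (at t within {r..s}))"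

definition twining_number :: "real \<Rightarrow> real \<Rightarrow> (real \<Rightarrow> bicomplex) \<Rightarrow> bicomplex \<Rightarrow> bicomplex" where
  "twining_number r s \<Gamma> p0 =
     (bic_of_real 1 \<oslash> (bic_of_real (2 * pi) \<odot> bic_j)) \<odot>
       bic_line_integral r s \<Gamma> (\<lambda>p. bic_of_real 1 \<oslash> (p - p0))"


section \<open>Orientable surfaces bounded by a curve\<close>

text \<open>Compact topological 2-manifolds with (possibly empty) boundary.\<close>

definition compact_surface :: "'a::euclidean_space set \<Rightarrow> bool" where
  "compact_surface M \<longleftrightarrow> compact M \<and>
     (\<forall>x\<in>M. \<exists>U V. x \<in> U \<and> openin (top_of_set M) U \<and>
        openin (top_of_set {z::complex. 0 \<le> Im z}) V \<and> U homeomorphic V)"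

text \<open>The manifold boundary: the points without a Euclidean neighbourhood.\<close>

definition surface_boundary :: "'a::euclidean_space set \<Rightarrow> 'a set" where
  "surface_boundary M =
     {x\<in>M. \<not> (\<exists>U V. x \<in> U \<and> openin (top_of_set M) U \<and> open (V::complex set) \<and> U homeomorphic V)}"

text \<open>
  Orientability in the classical sense, for a surface that is the union of a simplicial complex:
  the triangles can be oriented so that any two triangles with a common edge induce opposite
  directions on it. An orientation of a triangle is given by the set of directed edges
  of one of its two cyclic orders of vertices; two triangles induce the same direction on a
  common edge exactly if these sets intersect.
\<close>

definition orientable_polyhedron :: "'a::euclidean_space set \<Rightarrow> bool" where
  "orientable_polyhedron M \<longleftrightarrow>
     (\<exists>\<C> ori. simplicial_complex \<C> \<and> \<Union>\<C> = M \<and>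
        (\<forall>T\<in>\<C>. 2 simplex T \<longrightarrow>
           (\<exists>a b c. T = convex hull {a, b, c} \<and> ori T = {(a, b), (b, c), (c, a)})) \<and>
        (\<forall>T\<in>\<C>. \<forall>T'\<in>\<C>. 2 simplex T \<and> 2 simplex T' \<and> T \<noteq> T' \<longrightarrow> ori T \<inter> ori T' = {}))"

text \<open>
  \<open>S\<close> is an orientable surface bounded by the closed curve \<open>\<Gamma>\<close>: it is parametrized by a continuous
  map \<open>h\<close> on a compact orientable surface \<open>M\<close>, and \<open>\<Gamma>\<close> is the image under \<open>h\<close> of a simple closed
  parametrization \<open>\<gamma>\<close> of the boundary of \<open>M\<close>. If \<open>h\<close> is injective, then \<open>S\<close> is an embedded
  surface; in general \<open>\<Gamma>\<close>, hence also \<open>S\<close>, may intersect itself. Taking \<open>M\<close> to be a polyhedron in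
  real 4-space is no restriction, since every compact surface is triangulable and every compact
  orientable surface is homeomorphic to a polyhedron in 3-space.
\<close>

definition orientable_surface_bounded_by ::
    "bicomplex set \<Rightarrow> real \<Rightarrow> real \<Rightarrow> (real \<Rightarrow> bicomplex) \<Rightarrow> bool" where
  "orientable_surface_bounded_by S r s \<Gamma> \<longleftrightarrow>
     (\<exists>(M::bicomplex set) h \<gamma>.
        compact_surface M \<and> orientable_polyhedron M \<and>
        continuous_on M h \<and> h ` M = S \<and>
        continuous_on {r..s} \<gamma> \<and> \<gamma> r = \<gamma> s \<and> inj_on \<gamma> {r..<s} \<and>
        \<gamma> ` {r..s} = surface_boundary M \<and>
        (\<forall>t\<in>{r..s}. \<Gamma> t = h (\<gamma> t)))"

end

theory Submission
  imports Defs "HOL-Complex_Analysis.Cauchy_Integral_Formula"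
begin

text \<open>
  The ring homomorphisms \<open>(a, b) \<mapsto> a + c b\<close> with \<open>c = \<i>\<close> and \<open>c = -\<i>\<close> identify the bicomplex numbers
  with the product ring of pairs of complex numbers, and nonsingular means that both coordinates
  are nonzero. In the coordinate \<open>z\<close> belonging to \<open>c\<close>, a component \<open>f\<close> of a holomorphic function is
  locally a holomorphic function of \<open>z\<close> alone, so \<open>f dz\<close> is locally exact, as are
  \<open>f / (z - z0) dz\<close> away from \<open>z = z0\<close> and \<open>(f - f(p0)) / (z - z0) dz\<close> near \<open>p0\<close>. It remains to
  see that a locally exact form integrates to zero over the boundary of an orientable surface.
  Pulled back to the triangulated parameter surface, the form has a primitive on every triangle,
  so its integrals around the coherently oriented triangles vanish; interior edges cancel, and
  the remaining edges make up the boundary curve, up to its direction.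
\<close>

section \<open>Complex coordinates of bicomplex numbers\<close>

text \<open>The surface is only a continuous image of a polyhedron, so the form cannot be pulled
  back pointwise and Stokes' theorem is out of reach. What survives a continuous map are increments
  of local primitives over short distances, and all integrals in the surface are built from these.
  The parametrization of the boundary bears no relation to the triangulation: its base point may lie
  inside an edge, its direction is arbitrary, and its edges would have to be put in order. This is
  avoided by cutting the curve along a piece of a single boundary edge. On the rest of the curve the
  form is the increment of a function \<open>g\<close>; subtracting the increments of
  \<open>g\<close> from all edges keeps the sums around triangles zero and kills every other
  boundary edge, so the chosen edge alone carries the period up to sign, and the period is zero.
  This requires that unpaired edges consist of boundary points and that one exists, which rests on
  invariance of domain and of dimension. A separate obstacle comes first: a limit over nonsingular
  increments does not at once make \<open>\<psi>\<close> continuous.\<close>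

definition pr :: "complex \<Rightarrow> bicomplex \<Rightarrow> complex" where
  "pr c p = fst p + c * snd p"

lemma bounded_linear_pr: "bounded_linear (pr c)"
  unfolding pr_def
  by (intro bounded_linear_add bounded_linear_fst bounded_linear_const_mult bounded_linear_snd)

lemmas pr_add = bounded_linear_pr[THEN bounded_linear.linear, THEN linear_add]
lemmas pr_diff = bounded_linear_pr[THEN bounded_linear.linear, THEN linear_diff]
lemmas pr_0 [simp] = bounded_linear_pr[THEN bounded_linear.linear, THEN linear_0]

lemma norm_pr_le:
  assumes "c\<^sup>2 = -1"
  shows "norm (pr c p) \<le> 2 * norm p"
proof -
  have "norm c = 1"
    using assms by (metis norm_minus_cancel norm_one norm_power norm_ge_zero power2_eq_1_iff
        power_one real_sqrt_unique abs_norm_cancel real_sqrt_abs real_sqrt_one)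
  then have "norm (pr c p) \<le> norm (fst p) + norm (snd p)"
    unfolding pr_def by (metis mult_1 norm_mult norm_triangle_ineq)
  then show ?thesis
    using norm_fst_le[of "fst p" "snd p"] norm_snd_le[of "snd p" "fst p"] by simp
qed

lemma pr_times:
  assumes "c\<^sup>2 = -1"
  shows "pr c (p \<odot> q) = pr c p * pr c q"
  using assms unfolding pr_def bic_times_def fst_conv snd_conv by algebra

lemma nonsingular_iff: "nonsingular p \<longleftrightarrow> pr \<i> p \<noteq> 0 \<and> pr (-\<i>) p \<noteq> 0"
proof -
  have "pr \<i> p * pr (-\<i>) p = (fst p)\<^sup>2 + (snd p)\<^sup>2"
    by (simp add: pr_def power2_eq_square algebra_simps)
  then show ?thesis unfolding nonsingular_def by (metis mult_eq_0_iff)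
qed

lemma square_eq_minus_one_iff: "c\<^sup>2 = -1 \<longleftrightarrow> c = \<i> \<or> c = -\<i>" for c :: complex
proof -
  have "c\<^sup>2 + 1 = (c - \<i>) * (c + \<i>)" by (simp add: power2_eq_square algebra_simps)
  then show ?thesis
    by (metis add_eq_0_iff2 eq_iff_diff_eq_0 minus_equation_iff mult_eq_0_iff)
qed

lemma pr_nonzero: "c\<^sup>2 = -1 \<Longrightarrow> nonsingular p \<Longrightarrow> pr c p \<noteq> 0"
  by (auto simp: square_eq_minus_one_iff nonsingular_iff)

lemma pr_divide:
  assumes "c\<^sup>2 = -1" "nonsingular q"
  shows "pr c (p \<oslash> q) = pr c p / pr c q"
proof -
  have ns: "(fst q)\<^sup>2 + (snd q)\<^sup>2 \<noteq> 0" using assms(2) by (simp add: nonsingular_def)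
  have "pr c q * pr c (bic_inverse q) = pr c (q \<odot> bic_inverse q)"
    by (simp add: pr_times assms)
  also have "q \<odot> bic_inverse q = (1, 0)"
    using ns by (simp add: bic_times_def bic_inverse_def power2_eq_square prod_eq_iff
        flip: add_divide_distrib diff_divide_distrib)
  finally have "pr c q * pr c (bic_inverse q) = 1" by (simp add: pr_def)
  then show ?thesis
    using pr_nonzero[OF assms] unfolding bic_divide_def pr_times[OF assms(1)]
    by (simp add: field_simps)
qed

text \<open>The derivative only controls nonsingular increments; a singular increment \<open>d\<close> is the limit of
  the increments \<open>d + x\<close> with \<open>x\<close> real, which are nonsingular for small \<open>x \<noteq> 0\<close>.\<close>

definition real_shift :: "real \<Rightarrow> bicomplex" where
  "real_shift x = (of_real x, 0)"

lemma real_shift_tendsto_0: "(real_shift \<longlongrightarrow> 0) (at 0)"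
  unfolding real_shift_def zero_prod_def by (intro tendsto_eq_intros) auto

lemma pr_real_shift [simp]: "pr c (real_shift x) = of_real x"
  by (simp add: real_shift_def pr_def)

text \<open>A real shift adds the same \<open>x\<close> to both coordinates, so a coordinate of the
  sum vanishes only if that coordinate of \<open>d\<close> is \<open>-x\<close>. The gap
  \<open>\<delta>\<close> between zero and the nonzero coordinates of \<open>d\<close> rules this
  out.\<close>

lemma nonsingular_add_real_shift:
  assumes x: "\<bar>x\<bar> < \<delta>" "x \<noteq> 0"
    and d: "\<forall>c\<in>{\<i>, -\<i>}. pr c d = 0 \<or> \<delta> \<le> norm (pr c d)"
  shows "nonsingular (d + real_shift x)"
proof -
    have "pr c (d + real_shift x) \<noteq> 0" if "c \<in> {\<i>, -\<i>}" for c
    proof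
      assume "pr c (d + real_shift x) = 0"
      then have "pr c d + of_real x = 0" unfolding pr_add pr_real_shift .
      then have "pr c d = - of_real x" by (rule eq_neg_iff_add_eq_0[THEN iffD2])
      then have "norm (pr c d) = \<bar>x\<bar>" "pr c d \<noteq> 0" using x(2) by simp_all
      moreover have "pr c d = 0 \<or> \<delta> \<le> norm (pr c d)" using d that by blast
      ultimately show False using x(1) by simp
    qed
    then show ?thesis by (simp add: nonsingular_iff)
qed

section \<open>Total derivatives from nonsingular increments\<close>

lemma pr_quotient_tendsto:
  assumes c: "c\<^sup>2 = -1" and hol: "bic_holomorphic_on \<psi> G" and q: "q \<in> G"
  obtains D where "((\<lambda>d. (pr c (\<psi> (q + d)) - pr c (\<psi> q)) / pr c d) \<longlongrightarrow> D) (at 0 within {d. nonsingular d})"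
proof -
    obtain D where "((\<lambda>d. (\<psi> (q + d) - \<psi> q) \<oslash> d) \<longlongrightarrow> D) (at 0 within {d. nonsingular d})"
      using hol q unfolding bic_holomorphic_on_def by blast
    then have "((\<lambda>d. pr c ((\<psi> (q + d) - \<psi> q) \<oslash> d)) \<longlongrightarrow> pr c D) (at 0 within {d. nonsingular d})"
      by (rule bounded_linear.tendsto[OF bounded_linear_pr])
    then have "((\<lambda>d. (pr c (\<psi> (q + d)) - pr c (\<psi> q)) / pr c d) \<longlongrightarrow> pr c D) (at 0 within {d. nonsingular d})"
      by (rule tendsto_cong[THEN iffD1, rotated])
        (auto simp: eventually_at_filter pr_divide c pr_diff)
    then show ?thesis by (rule that)
qed

text \<open>Continuity along real increments is all the continuity at hand before differentiability
  is known; it carries estimates from nonsingular to singular increments.\<close>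

lemma quotient_tendsto_imp_shift_tendsto:
  assumes D: "((\<lambda>d. (f (q + d) - f q) / pr c d) \<longlongrightarrow> D) (at 0 within {d. nonsingular d})"
  shows "((\<lambda>x. f (q + real_shift x)) \<longlongrightarrow> f q) (at 0)"
proof -
    have "\<forall>\<^sub>F x in at 0. real_shift x \<in> {d. nonsingular d} \<and> real_shift x \<noteq> 0"
      by (auto simp: eventually_at_filter nonsingular_def real_shift_def zero_prod_def)
    then have "filterlim real_shift (at 0 within {d. nonsingular d}) (at 0)"
      unfolding filterlim_at using real_shift_tendsto_0 by simp
    from filterlim_compose[OF D this]
    have "((\<lambda>x. (f (q + real_shift x) - f q) / of_real x) \<longlongrightarrow> D) (at 0)" by simp
    then have "((\<lambda>x. (f (q + real_shift x) - f q) / of_real x * of_real x + f q) \<longlongrightarrow> D * of_real 0 + f q) (at 0)"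
      by (intro tendsto_intros)
    moreover have "\<forall>\<^sub>F x in at 0. (f (q + real_shift x) - f q) / of_real x * of_real x + f q = f (q + real_shift x)"
      by (simp add: eventually_at_filter)
    ultimately have "((\<lambda>x. f (q + real_shift x)) \<longlongrightarrow> D * of_real 0 + f q) (at 0)"
      by (rule Lim_transform_eventually)
    then show ?thesis by simp
qed

text \<open>The derivative estimate holds for small nonsingular \<open>d\<close>. Both of its sides
  are continuous along real shifts of \<open>d\<close>, and small nonzero shifts make
  \<open>d\<close> nonsingular, so the inequality passes to the limit at every small
  \<open>d\<close>. The assumption \<open>cont\<close> covers a ball because the shifts start at
  \<open>p + d\<close>, not at \<open>p\<close>.\<close>

lemma quotient_tendsto_imp_has_derivative:
  assumes c: "c\<^sup>2 = -1" and \<rho>: "\<rho> > 0"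
    and cont: "\<And>q. q \<in> ball p \<rho> \<Longrightarrow> ((\<lambda>x. f (q + real_shift x)) \<longlongrightarrow> f q) (at 0)"
    and D: "((\<lambda>d. (f (p + d) - f p) / pr c d) \<longlongrightarrow> D) (at 0 within {d. nonsingular d})"
  shows "(f has_derivative (\<lambda>d. D * pr c d)) (at p)"
    unfolding has_derivative_at_alt
  proof (intro conjI allI impI)
    show "bounded_linear (\<lambda>d. D * pr c d)"
      by (intro bounded_linear_const_mult bounded_linear_pr)
    fix e :: real assume "e > 0"
    \<comment> \<open>The half makes up for the factor 2 in \<open>norm_pr_le\<close>.\<close>
    then have "\<forall>\<^sub>F d in at 0 within {d. nonsingular d}. dist ((f (p + d) - f p) / pr c d) D < e/2"
      using D by (intro tendstoD) auto
    then obtain \<delta> where \<delta>: "\<delta> > 0" and ns: "\<And>d. nonsingular d \<Longrightarrow> d \<noteq> 0 \<Longrightarrow> norm d < \<delta> \<Longrightarrow>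
        dist ((f (p + d) - f p) / pr c d) D < e/2"
      unfolding eventually_at by (auto simp: dist_norm)
    have ns': "norm (f (p + d) - f p - D * pr c d) \<le> e * norm d" if d: "nonsingular d" "norm d < \<delta>" for d
    proof -
      have 0: "pr c d \<noteq> 0" using c d pr_nonzero by blast
      have "f (p + d) - f p - D * pr c d = ((f (p + d) - f p) / pr c d - D) * pr c d"
        using 0 by (simp add: field_simps)
      then have "norm (f (p + d) - f p - D * pr c d) = dist ((f (p + d) - f p) / pr c d) D * norm (pr c d)"
        by (simp add: norm_mult dist_norm)
      also have "\<dots> \<le> e/2 * (2 * norm d)"
      proof (rule mult_mono)
        have "d \<noteq> 0" using 0 by auto
        then show "dist ((f (p + d) - f p) / pr c d) D \<le> e/2" using ns[of d] d by simp
      qed (use norm_pr_le[OF c, of d] \<open>e > 0\<close> in auto)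
      finally show ?thesis by simp
    qed
    show "\<exists>\<delta>>0. \<forall>y. norm (y - p) < \<delta> \<longrightarrow> norm (f y - f p - D * pr c (y - p)) \<le> e * norm (y - p)"
    proof (intro exI[of _ "min \<delta> \<rho>"] conjI allI impI)
      fix y assume y: "norm (y - p) < min \<delta> \<rho>"
      define d where "d = y - p"
      have "y \<in> ball p \<rho>" using y by (simp add: dist_norm norm_minus_commute)
      \<comment> \<open>A vanishing coordinate puts no bound on the shift; the value 1 then keeps
        the minimum positive.\<close>
      define \<eta> where "\<eta> = (\<lambda>c. if pr c d = 0 then 1 else norm (pr c d))"
      have \<eta>: "min (\<eta> \<i>) (\<eta> (-\<i>)) > 0" by (simp add: \<eta>_def)
      have \<eta>': "\<forall>c\<in>{\<i>, -\<i>}. pr c d = 0 \<or> min (\<eta> \<i>) (\<eta> (-\<i>)) \<le> norm (pr c d)"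
      proof
        fix c assume "c \<in> {\<i>, -\<i>}"
        then have "min (\<eta> \<i>) (\<eta> (-\<i>)) \<le> \<eta> c" by (elim insertE) simp_all
        then show "pr c d = 0 \<or> min (\<eta> \<i>) (\<eta> (-\<i>)) \<le> norm (pr c d)"
          by (cases "pr c d = 0") (simp_all add: \<eta>_def)
      qed
      have py: "p + (d + real_shift x) = y + real_shift x" for x by (simp add: d_def)
      have lim1: "((\<lambda>x. norm (f (p + (d + real_shift x)) - f p - D * pr c (d + real_shift x))) \<longlongrightarrow> norm (f y - f p - D * pr c (d + 0))) (at 0)"
        unfolding py
        by (intro tendsto_intros bounded_linear.tendsto[OF bounded_linear_pr] real_shift_tendsto_0 cont \<open>y \<in> ball p \<rho>\<close>)
      have lim2: "((\<lambda>x. e * norm (d + real_shift x)) \<longlongrightarrow> e * norm (d + 0)) (at 0)"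
        by (intro tendsto_intros real_shift_tendsto_0)
      have "((\<lambda>x. norm (d + real_shift x)) \<longlongrightarrow> norm (d + 0)) (at 0)"
        by (intro tendsto_intros real_shift_tendsto_0)
      then have "\<forall>\<^sub>F x in at 0. norm (d + real_shift x) < \<delta>"
        by (rule order_tendstoD) (use y in \<open>auto simp: d_def\<close>)
      moreover have "\<forall>\<^sub>F x in at 0. \<bar>x\<bar> < min (\<eta> \<i>) (\<eta> (-\<i>)) \<and> x \<noteq> 0"
        unfolding eventually_at using \<eta> by (intro exI[of _ "min (\<eta> \<i>) (\<eta> (-\<i>))"]) (simp add: dist_real_def)
      ultimately have "\<forall>\<^sub>F x in at 0. norm (f (p + (d + real_shift x)) - f p - D * pr c (d + real_shift x)) \<le> e * norm (d + real_shift x)"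
      proof eventually_elim
        case (elim x)
        have "nonsingular (d + real_shift x)" by (rule nonsingular_add_real_shift[OF _ _ \<eta>']) (use elim in blast)+
        then show ?case using elim(1) by (rule ns')
      qed
      from tendsto_le[OF _ lim2 lim1 this]
      show "norm (f y - f p - D * pr c (y - p)) \<le> e * norm (y - p)"
        by (simp add: d_def)
    qed (use \<delta> \<rho> in auto)
  qed

lemma pr_holomorphic_has_derivative:
  assumes c: "c\<^sup>2 = -1" and hol: "bic_holomorphic_on \<psi> G" and G: "open G" "p \<in> G"
  shows "\<exists>D. ((\<lambda>q. pr c (\<psi> q)) has_derivative (\<lambda>d. D * pr c d)) (at p)"
proof -
  obtain \<rho> where \<rho>: "\<rho> > 0" "ball p \<rho> \<subseteq> G" using G by (meson openE)
  obtain D where D: "((\<lambda>d. (pr c (\<psi> (p + d)) - pr c (\<psi> p)) / pr c d) \<longlongrightarrow> D) (at 0 within {d. nonsingular d})"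
    using pr_quotient_tendsto[OF c hol G(2)] .
  have "((\<lambda>x. pr c (\<psi> (q + real_shift x))) \<longlongrightarrow> pr c (\<psi> q)) (at 0)" if "q \<in> ball p \<rho>" for q
  proof -
    have "q \<in> G" using that \<rho>(2) by blast
    then obtain D' where "((\<lambda>d. (pr c (\<psi> (q + d)) - pr c (\<psi> q)) / pr c d) \<longlongrightarrow> D') (at 0 within {d. nonsingular d})"
      using pr_quotient_tendsto[OF c hol] by blast
    then show ?thesis by (rule quotient_tendsto_imp_shift_tendsto)
  qed
  from quotient_tendsto_imp_has_derivative[OF c \<rho>(1) this D] show ?thesis by blast
qed

section \<open>Factorization through one coordinate\<close>

text \<open>The points \<open>(z/2, -c*z/2)\<close> are the complex multiples of the idempotent
  \<open>(1/2, -c/2)\<close>; their coordinate belonging to \<open>-c\<close> is zero.\<close>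

lemma pr_section:
  assumes c: "c\<^sup>2 = -1"
  shows "pr c (z/2, -c*z/2) = z"
proof -
  have "pr c (z/2, -c*z/2) = z/2 - c\<^sup>2*z/2" by (simp add: pr_def power2_eq_square)
  then show ?thesis by (simp add: c)
qed

lemma norm_section_le:
  fixes c :: complex
  assumes c: "c\<^sup>2 = -1"
  shows "norm (z/2, -c*z/2) \<le> norm z"
proof -
  have "norm c = 1" using c by (auto simp: square_eq_minus_one_iff)
  then show ?thesis using norm_Pair_le[of "z/2" "-c*z/2"] by (simp add: norm_mult norm_divide)
qed

text \<open>The derivative \<open>D * pr c d\<close> vanishes in the direction
  \<open>q' - q\<close>, so \<open>f\<close> is constant along the segment between the points, which
  convexity keeps inside \<open>B\<close>.\<close>

lemma eq_on_fibre:
  assumes der: "\<And>q. q \<in> B \<Longrightarrow> \<exists>D. (f has_derivative (\<lambda>d. D * pr c d)) (at q)"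
    and B: "convex B" "q \<in> B" "q' \<in> B" and eq: "pr c q = pr c q'"
  shows "f q = f q'"
proof -
  have "f (q + 0 *\<^sub>R (q' - q)) = f (q + 1 *\<^sub>R (q' - q))"
  proof (rule has_derivative_zero_unique[of "{0..1}" "\<lambda>t::real. f (q + t *\<^sub>R (q' - q))" 0 1])
    fix t :: real assume "t \<in> {0..1}"
    then have "q + t *\<^sub>R (q' - q) \<in> B"
      using convexD_alt[OF B, of t] by (simp add: algebra_simps)
    then obtain D where D: "(f has_derivative (\<lambda>d. D * pr c d)) (at (q + t *\<^sub>R (q' - q)))"
      using der by blast
    have "((\<lambda>t. q + t *\<^sub>R (q' - q)) has_derivative (\<lambda>x. x *\<^sub>R (q' - q))) (at t within {0..1})"
      by (auto intro!: derivative_eq_intros)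
    from has_derivative_compose[OF this D]
    have "((\<lambda>t. f (q + t *\<^sub>R (q' - q))) has_derivative (\<lambda>x. D * pr c (x *\<^sub>R (q' - q)))) (at t within {0..1})" .
    moreover have "pr c (x *\<^sub>R (q' - q)) = 0" for x
      using eq by (simp add: linear_cmul[OF bounded_linear.linear[OF bounded_linear_pr]] pr_diff)
    ultimately show "((\<lambda>t. f (q + t *\<^sub>R (q' - q))) has_derivative (\<lambda>x. 0)) (at t within {0..1})"
      by simp
  qed auto
  then show ?thesis by simp
qed

text \<open>\<open>g\<close> is \<open>f\<close> on the complex line through \<open>p\<close> along
  which the other coordinate is constant; constancy on fibres moves any other point to that line.
  The radius is halved because \<open>pr c\<close> may double distances.\<close>

lemma factor_through_pr:
  assumes c: "c\<^sup>2 = -1" and \<rho>: "\<rho> > 0"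
    and der: "\<And>q. q \<in> ball p \<rho> \<Longrightarrow> \<exists>D. (f has_derivative (\<lambda>d. D * pr c d)) (at q)"
  obtains g where "g holomorphic_on ball (pr c p) \<rho>"
    "\<And>q. q \<in> ball p (\<rho>/2) \<Longrightarrow> pr c q \<in> ball (pr c p) \<rho> \<and> f q = g (pr c q)"
proof -
  define l where "l z = p + ((z - pr c p)/2, -c*(z - pr c p)/2)" for z
  have l_in: "l z \<in> ball p \<rho>" if "z \<in> ball (pr c p) \<rho>" for z
  proof -
    have "dist p (p + v) = norm v" for v by (simp add: dist_norm)
    then show ?thesis
      using norm_section_le[OF c, of "z - pr c p"] that
      by (simp only: l_def mem_ball dist_norm[of "pr c p"] norm_minus_commute[of "pr c p"])
  qed
  have pr_l: "pr c (l z) = z" for z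
    unfolding l_def pr_add pr_section[OF c] by simp
  show ?thesis
  proof (rule that[of "f \<circ> l"])
    have "(f \<circ> l) field_differentiable (at z)" if z: "z \<in> ball (pr c p) \<rho>" for z
    proof -
      obtain D where D: "(f has_derivative (\<lambda>d. D * pr c d)) (at (l z))"
        using der l_in[OF z] by blast
      have "(l has_derivative (\<lambda>x. (x/2, -c*x/2))) (at z)"
        unfolding l_def by (auto intro!: derivative_eq_intros simp: algebra_simps)
      from has_derivative_compose[OF this D] have "((f \<circ> l) has_field_derivative D) (at z)"
        unfolding pr_section[OF c] has_field_derivative_def o_def
        by (rule has_derivative_eq_rhs) (simp add: fun_eq_iff)
      then show ?thesis by (auto simp: field_differentiable_def)
    qed
    then show "(f \<circ> l) holomorphic_on ball (pr c p) \<rho>"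
      by (simp add: holomorphic_on_open field_differentiable_def)
    fix q assume q: "q \<in> ball p (\<rho>/2)"
    have *: "pr c q \<in> ball (pr c p) \<rho>"
      using norm_pr_le[OF c, of "p - q"] q by (simp add: dist_norm pr_diff)
    moreover have "f q = f (l (pr c q))"
    proof (rule eq_on_fibre[where B = "ball p \<rho>" and c = c])
      show "q \<in> ball p \<rho>" by (rule subsetD[OF subset_ball q]) (use \<rho> in simp)
    qed (simp_all only: der convex_ball l_in[OF *] pr_l)
    ultimately show "pr c q \<in> ball (pr c p) \<rho> \<and> f q = (f \<circ> l) (pr c q)" by simp
  qed
qed

section \<open>Locally exact forms from holomorphic components\<close>

text \<open>A form is a function of a point and a tangent vector. The ball is taken in the ambient
  space, not in \<open>S\<close>, so that primitives can be differentiated even if \<open>S\<close>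
  is a thin set such as a curve or a surface.\<close>

definition locally_exact ::
    "('a::real_normed_vector \<Rightarrow> 'a \<Rightarrow> 'b::real_normed_vector) \<Rightarrow> 'a set \<Rightarrow> bool" where
  "locally_exact \<omega> S \<longleftrightarrow> (\<forall>p\<in>S. \<exists>\<rho>>0. \<exists>\<Phi>. \<forall>q\<in>ball p \<rho>. (\<Phi> has_derivative \<omega> q) (at q))"

text \<open>The form is the pullback of \<open>g z dz\<close> under \<open>pr c\<close>, and
  holomorphic functions have primitives on discs.\<close>

lemma primitive_of_factored:
  assumes "g holomorphic_on ball w r" "r > 0"
    and "\<And>q. q \<in> ball p \<rho> \<Longrightarrow> pr c q \<in> ball w r \<and> f q = g (pr c q)"
  obtains \<Phi> where "\<And>q. q \<in> ball p \<rho> \<Longrightarrow> (\<Phi> has_derivative (\<lambda>d. f q * pr c d)) (at q)"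
proof -
  obtain h where h: "\<And>z. z \<in> ball w r \<Longrightarrow> (h has_field_derivative g z) (at z within ball w r)"
    by (rule holomorphic_convex_primitive'[OF convex_ball open_ball assms(1)]) blast
  show ?thesis
  proof (rule that[of "h \<circ> pr c"])
    fix q assume "q \<in> ball p \<rho>"
    from assms(3)[OF this] have q: "pr c q \<in> ball w r" "f q = g (pr c q)" by blast+
    have "(h has_derivative (*) (g (pr c q))) (at (pr c q))"
      using h[OF q(1)] unfolding at_within_open[OF q(1) open_ball] has_field_derivative_def .
    from has_derivative_compose[OF bounded_linear_imp_has_derivative[OF bounded_linear_pr] this]
    show "((h \<circ> pr c) has_derivative (\<lambda>d. f q * pr c d)) (at q)"
      unfolding q(2) o_def .
  qed
qed

lemma locally_exact_pr:
  assumes c: "c\<^sup>2 = -1" and U: "open U" "S \<subseteq> U"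
    and der: "\<And>q. q \<in> U \<Longrightarrow> \<exists>D. (f has_derivative (\<lambda>d. D * pr c d)) (at q)"
  shows "locally_exact (\<lambda>q d. f q * pr c d) S"
  unfolding locally_exact_def
proof
  fix p assume "p \<in> S"
  then obtain \<rho> where \<rho>: "\<rho> > 0" "ball p \<rho> \<subseteq> U" using U by (meson openE subsetD)
  obtain g where "g holomorphic_on ball (pr c p) \<rho>"
    "\<And>q. q \<in> ball p (\<rho>/2) \<Longrightarrow> pr c q \<in> ball (pr c p) \<rho> \<and> f q = g (pr c q)"
    using factor_through_pr[OF c \<rho>(1), of p f] der \<rho>(2) by blast
  then obtain \<Phi> where "\<And>q. q \<in> ball p (\<rho>/2) \<Longrightarrow> (\<Phi> has_derivative (\<lambda>d. f q * pr c d)) (at q)"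
    using primitive_of_factored[OF _ \<rho>(1)] by blast
  then show "\<exists>\<rho>>0. \<exists>\<Phi>. \<forall>q\<in>ball p \<rho>. (\<Phi> has_derivative (\<lambda>d. f q * pr c d)) (at q)"
    using half_gt_zero[OF \<rho>(1)] by blast
qed

lemma pr_quotient_has_derivative:
  assumes "(f has_derivative (\<lambda>d. D * pr c d)) (at q)" "pr c q \<noteq> w"
  shows "\<exists>D. ((\<lambda>q. (f q - k) / (pr c q - w)) has_derivative (\<lambda>d. D * pr c d)) (at q)"
proof -
  have "((\<lambda>q. (f q - k) / (pr c q - w)) has_derivative
      (\<lambda>d. ((D * pr c d) * (pr c q - w) - (f q - k) * pr c d) / ((pr c q - w) * (pr c q - w)))) (at q)"
    using assms by (auto intro!: derivative_eq_intros has_derivative_divide'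
        bounded_linear_imp_has_derivative bounded_linear_pr)
  also have "(\<lambda>d. ((D * pr c d) * (pr c q - w) - (f q - k) * pr c d) / ((pr c q - w) * (pr c q - w)))
      = (\<lambda>d. (D * (pr c q - w) - (f q - k)) / ((pr c q - w) * (pr c q - w)) * pr c d)"
    by (rule ext) (simp add: algebra_simps)
  finally show ?thesis by (rule exI)
qed

text \<open>The constant \<open>k\<close> is 0 for the quotients of \<open>\<psi>\<close> and of 1
  by \<open>z - z0\<close>, and it is \<open>f p0\<close> for the difference quotient away from
  \<open>p0\<close>.\<close>

lemma locally_exact_quotient:
  assumes c: "c\<^sup>2 = -1" and U: "open U" "S \<subseteq> U"
    and der: "\<And>q. q \<in> U \<Longrightarrow> \<exists>D. (f has_derivative (\<lambda>d. D * pr c d)) (at q)"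
    and ne: "\<And>q. q \<in> S \<Longrightarrow> pr c q \<noteq> w"
  shows "locally_exact (\<lambda>q d. (f q - k) / (pr c q - w) * pr c d) S"
proof (rule locally_exact_pr[OF c])
  have "continuous_on UNIV (pr c)"
    by (rule linear_continuous_on[OF bounded_linear_pr])
  then have "open (pr c -` (- {w}))" by (rule open_vimage[rotated]) (rule open_Compl[OF closed_singleton])
  then show "open (U \<inter> pr c -` (- {w}))" using U by (intro open_Int)
  show "S \<subseteq> U \<inter> pr c -` (- {w})" using U ne by auto
  show "\<exists>D. ((\<lambda>q. (f q - k) / (pr c q - w)) has_derivative (\<lambda>d. D * pr c d)) (at q)"
    if q: "q \<in> U \<inter> pr c -` (- {w})" for q
  proof -
    obtain D where "(f has_derivative (\<lambda>d. D * pr c d)) (at q)" using der[OF IntD1[OF q]] by blast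
    then show ?thesis by (rule pr_quotient_has_derivative) (use q in simp)
  qed
qed

text \<open>Near \<open>p0\<close> the function factors through one complex coordinate, so the
  singularity along the fibre of \<open>p0\<close> is removable as in one variable. At the other
  points of \<open>S\<close>, which are off that fibre, the plain quotient serves.\<close>

lemma locally_exact_difference_quotient:
  assumes c: "c\<^sup>2 = -1" and U: "open U" "S \<subseteq> U" "p0 \<in> U"
    and der: "\<And>q. q \<in> U \<Longrightarrow> \<exists>D. (f has_derivative (\<lambda>d. D * pr c d)) (at q)"
    and ne: "\<And>q. q \<in> S - {p0} \<Longrightarrow> pr c q \<noteq> pr c p0"
  obtains F where "locally_exact (\<lambda>q d. F q * pr c d) S"
    "\<And>q. pr c q \<noteq> pr c p0 \<Longrightarrow> F q = (f q - f p0) / (pr c q - pr c p0)"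
proof -
  obtain \<rho> where \<rho>: "\<rho> > 0" "ball p0 \<rho> \<subseteq> U" using U by (meson openE)
  obtain g where g: "g holomorphic_on ball (pr c p0) \<rho>"
    and fg: "\<And>q. q \<in> ball p0 (\<rho>/2) \<Longrightarrow> pr c q \<in> ball (pr c p0) \<rho> \<and> f q = g (pr c q)"
    using factor_through_pr[OF c \<rho>(1), of p0 f] der \<rho>(2) by blast
  \<comment> \<open>The value \<open>deriv g\<close> is the right one on the fibre near
    \<open>p0\<close>; on the rest of the fibre, which \<open>S\<close> avoids, it is a mere
    default.\<close>
  define F where "F q = (if pr c q = pr c p0 then deriv g (pr c p0) else (f q - f p0) / (pr c q - pr c p0))" for q
  define H where "H z = (if z = pr c p0 then deriv g (pr c p0) else (g z - g (pr c p0)) / (z - pr c p0))" for z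
  have "H holomorphic_on ball (pr c p0) \<rho>"
    unfolding H_def by (rule pole_lemma_open[OF g open_ball])
  moreover have "pr c q \<in> ball (pr c p0) \<rho> \<and> F q = H (pr c q)" if "q \<in> ball p0 (\<rho>/2)" for q
    using fg[OF that] fg[of p0] \<rho>(1) by (simp add: F_def H_def)
  ultimately obtain \<Phi> where \<Phi>: "\<And>q. q \<in> ball p0 (\<rho>/2) \<Longrightarrow> (\<Phi> has_derivative (\<lambda>d. F q * pr c d)) (at q)"
    using primitive_of_factored[OF _ \<rho>(1)] by blast
  have le: "locally_exact (\<lambda>q d. (f q - f p0) / (pr c q - pr c p0) * pr c d) (S - {p0})"
    by (rule locally_exact_quotient[OF c U(1) _ der]) (use U ne in auto)
  show ?thesis
  proof (rule that[of F])
    show "locally_exact (\<lambda>q d. F q * pr c d) S"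
      unfolding locally_exact_def
    proof
      fix p assume p: "p \<in> S"
      show "\<exists>\<rho>>0. \<exists>\<Phi>. \<forall>q\<in>ball p \<rho>. (\<Phi> has_derivative (\<lambda>d. F q * pr c d)) (at q)"
      proof (cases "p = p0")
        case True
        then show ?thesis using \<Phi> half_gt_zero[OF \<rho>(1)] by blast
      next
        case False
        then obtain r \<Psi> where r: "r > 0" and \<Psi>: "\<And>q. q \<in> ball p r \<Longrightarrow>
            (\<Psi> has_derivative (\<lambda>d. (f q - f p0) / (pr c q - pr c p0) * pr c d)) (at q)"
          using le p unfolding locally_exact_def by blast
        \<comment> \<open>On the fibre of \<open>p0\<close> the plain quotient is a division by zero
          and need not agree with \<open>F\<close>, so the ball has to miss the fibre. The half
          again accounts for the factor 2 in \<open>norm_pr_le\<close>.\<close>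
        define \<epsilon> where "\<epsilon> = norm (pr c p - pr c p0) / 2"
        have "\<epsilon> > 0" using ne p False by (simp add: \<epsilon>_def)
        have "pr c q \<noteq> pr c p0" if "q \<in> ball p \<epsilon>" for q
          using norm_pr_le[OF c, of "p - q"] that by (auto simp: \<epsilon>_def dist_norm pr_diff)
        then have "\<forall>q\<in>ball p (min r \<epsilon>). (\<Psi> has_derivative (\<lambda>d. F q * pr c d)) (at q)"
          using \<Psi> by (simp add: F_def)
        then show ?thesis using r \<open>\<epsilon> > 0\<close> by (meson min_less_iff_conj)
      qed
    qed
  qed (simp add: F_def)
qed

section \<open>Primitives of locally exact forms along maps\<close>

text \<open>Think of \<open>I a b\<close> as the integral of a form from \<open>a\<close> to a nearby point \<open>b\<close>; its values at points far
  apart are irrelevant.\<close>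

definition cocycle_on :: "'a::metric_space set \<Rightarrow> ('a \<Rightarrow> 'a \<Rightarrow> 'b::ab_group_add) \<Rightarrow> real \<Rightarrow> bool" where
  "cocycle_on X I \<delta> \<longleftrightarrow> \<delta> > 0 \<and> (\<forall>a\<in>X. \<forall>b\<in>X. \<forall>c\<in>X.
     dist a b < \<delta> \<longrightarrow> dist b c < \<delta> \<longrightarrow> dist a c < \<delta> \<longrightarrow> I a b + I b c = I a c)"

text \<open>Along a merely continuous \<open>u\<close> the form makes sense only through increments
  over short distances. Leaving the parameter set \<open>T\<close> general covers intervals,
  segments and triangles alike.\<close>

definition primitive_along ::
    "('a \<Rightarrow> 'a \<Rightarrow> 'b::ab_group_add) \<Rightarrow> 't::metric_space set \<Rightarrow> ('t \<Rightarrow> 'a) \<Rightarrow> ('t \<Rightarrow> 'b) \<Rightarrow> bool" where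
  "primitive_along I T u \<Psi> \<longleftrightarrow>
     (\<forall>t\<in>T. \<exists>\<epsilon>>0. \<forall>x\<in>T \<inter> ball t \<epsilon>. \<forall>y\<in>T \<inter> ball t \<epsilon>. \<Psi> y - \<Psi> x = I (u x) (u y))"

text \<open>A Lebesgue number of the cover of \<open>M\<close> by preimages of balls with a
  primitive makes \<open>\<delta>\<close> uniform. \<open>I x y\<close> is the increment of the
  primitive chosen for \<open>x\<close>; the second conclusion keeps that primitive available for
  differentiation.\<close>

lemma locally_exact_cocycle:
  fixes h :: "'a::euclidean_space \<Rightarrow> 'c::real_normed_vector" and \<omega> :: "'c \<Rightarrow> 'c \<Rightarrow> 'b::real_normed_vector"
  assumes M: "compact M" and h: "continuous_on M h" and ex: "locally_exact \<omega> (h ` M)"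
  obtains I \<delta> where "cocycle_on M I \<delta>"
    "\<And>x. x \<in> M \<Longrightarrow> \<exists>\<Phi>. (\<Phi> has_derivative \<omega> (h x)) (at (h x)) \<and>
        (\<forall>y\<in>M. dist x y < \<delta> \<longrightarrow> I x y = \<Phi> (h y) - \<Phi> (h x))"
proof -
  have "\<forall>x\<in>M. \<exists>\<rho> \<Phi>. \<rho> > 0 \<and> (\<forall>q\<in>ball (h x) \<rho>. (\<Phi> has_derivative \<omega> q) (at q))"
    using ex unfolding locally_exact_def by blast
  then obtain \<rho> \<Phi> where \<rho>: "\<And>x. x \<in> M \<Longrightarrow> \<rho> x > 0"
    and \<Phi>: "\<And>x q. x \<in> M \<Longrightarrow> q \<in> ball (h x) (\<rho> x) \<Longrightarrow> (\<Phi> x has_derivative \<omega> q) (at q)"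
    by metis
  have "\<exists>U. open U \<and> U \<inter> M = h -` ball (h x) (\<rho> x) \<inter> M" for x
    using h by (auto simp: continuous_on_open_invariant)
  then obtain U where U: "\<And>x. open (U x)" "\<And>x. U x \<inter> M = h -` ball (h x) (\<rho> x) \<inter> M"
    by metis
  have "x \<in> U x" if "x \<in> M" for x
  proof -
    have "x \<in> h -` ball (h x) (\<rho> x) \<inter> M" using that \<rho> by simp
    then show ?thesis using U(2)[of x] by blast
  qed
  then have "M \<subseteq> \<Union>(U ` M)" by blast
  moreover have "\<And>G. G \<in> U ` M \<Longrightarrow> open G" using U(1) by blast
  ultimately obtain \<delta> where \<delta>: "\<delta> > 0" "\<And>x. x \<in> M \<Longrightarrow> \<exists>G\<in>U ` M. ball x \<delta> \<subseteq> G"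
    using Heine_Borel_lemma[OF M] by blast
  then have "\<forall>x\<in>M. \<exists>p\<in>M. ball x \<delta> \<subseteq> U p" by simp
  then obtain P where P: "\<And>x. x \<in> M \<Longrightarrow> P x \<in> M" "\<And>x. x \<in> M \<Longrightarrow> ball x \<delta> \<subseteq> U (P x)"
    by metis
  define B where "B x = ball (h (P x)) (\<rho> (P x))" for x
  have hB: "h y \<in> B x" if "x \<in> M" "y \<in> M" "dist x y < \<delta>" for x y
  proof -
    have "y \<in> ball x \<delta>" using that by simp
    then have "y \<in> U (P x) \<inter> M" using P(2)[OF that(1)] that(2) by blast
    then show ?thesis using U(2)[of "P x"] by (auto simp: B_def)
  qed
  define I where "I x y = \<Phi> (P x) (h y) - \<Phi> (P x) (h x)" for x y
  \<comment> \<open>Both primitives live on balls, whose intersection is convex, so there they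
    differ by a constant. Hence nearby increments do not depend on which primitive was
    chosen.\<close>
  have switch: "\<Phi> (P a) v - \<Phi> (P a) u = \<Phi> (P b) v - \<Phi> (P b) u"
    if "a \<in> M" "b \<in> M" "u \<in> B a \<inter> B b" "v \<in> B a \<inter> B b" for a b u v
  proof -
    have "\<Phi> (P a) u - \<Phi> (P b) u = \<Phi> (P a) v - \<Phi> (P b) v"
    proof (rule has_derivative_zero_unique[of "B a \<inter> B b"])
      show "convex (B a \<inter> B b)" unfolding B_def by (intro convex_Int convex_ball)
      fix q assume "q \<in> B a \<inter> B b"
      then have "(\<Phi> (P a) has_derivative \<omega> q) (at q)" "(\<Phi> (P b) has_derivative \<omega> q) (at q)"
        using \<Phi> P(1) that by (auto simp: B_def)
      from has_derivative_diff[OF this]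
      show "((\<lambda>q. \<Phi> (P a) q - \<Phi> (P b) q) has_derivative (\<lambda>h. 0)) (at q within B a \<inter> B b)"
        by (simp add: has_derivative_at_withinI)
    qed (use that in auto)
    then show ?thesis by (simp add: algebra_simps)
  qed
  show ?thesis
  proof (rule that[of I \<delta>])
    show "cocycle_on M I \<delta>"
      unfolding cocycle_on_def
    proof (intro conjI ballI impI)
      fix a b c assume *: "a \<in> M" "b \<in> M" "c \<in> M" "dist a b < \<delta>" "dist b c < \<delta>" "dist a c < \<delta>"
      have "I b c = \<Phi> (P a) (h c) - \<Phi> (P a) (h b)"
        unfolding I_def using * \<delta>(1) by (intro switch) (auto intro!: hB)
      then show "I a b + I b c = I a c" by (simp add: I_def)
    qed (rule \<delta>)
    show "\<exists>\<Phi>. (\<Phi> has_derivative \<omega> (h x)) (at (h x)) \<and>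
        (\<forall>y\<in>M. dist x y < \<delta> \<longrightarrow> I x y = \<Phi> (h y) - \<Phi> (h x))" if "x \<in> M" for x
    proof (intro exI conjI ballI impI)
      show "(\<Phi> (P x) has_derivative \<omega> (h x)) (at (h x))"
        using \<Phi>[OF P(1)[OF that]] hB[OF that that] \<delta>(1) by (simp add: B_def)
    qed (simp add: I_def)
  qed
qed

text \<open>The primitive at \<open>x\<close> adds up \<open>I\<close> over many short steps on the
  straight line from a fixed \<open>x0\<close> to \<open>x\<close>. The lines to two neighbouring
  points form a ladder of small quadrilaterals, across each of which the cocycle identity
  holds.\<close>

lemma primitive_along_exists:
  fixes u :: "'t::euclidean_space \<Rightarrow> 'a::metric_space"
  assumes T: "convex T" "compact T" and u: "continuous_on T u" "u ` T \<subseteq> X" and I: "cocycle_on X I \<delta>"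
  shows "\<exists>\<Psi>. primitive_along I T u \<Psi>"
proof (cases "T = {}")
  case False
  then obtain x0 where x0: "x0 \<in> T" by blast
  have "uniformly_continuous_on T u" using T u by (simp add: compact_uniformly_continuous)
  then obtain \<epsilon> where \<epsilon>: "\<epsilon> > 0" "\<And>x y. x \<in> T \<Longrightarrow> y \<in> T \<Longrightarrow> dist x y < \<epsilon> \<Longrightarrow> dist (u x) (u y) < \<delta>"
    using I unfolding uniformly_continuous_on_def cocycle_on_def by (metis dist_commute)
  define K where "K x y = I (u x) (u y)" for x y
  have K: "K a b + K b c = K a c"
    if "a \<in> T" "b \<in> T" "c \<in> T" "dist a b < \<epsilon>" "dist b c < \<epsilon>" "dist a c < \<epsilon>" for a b c
    using I u(2) \<epsilon>(2) that unfolding K_def cocycle_on_def by blast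
  obtain R where R: "\<And>x. x \<in> T \<Longrightarrow> dist x0 x \<le> R"
    using bounded_any_center[of T x0] compact_imp_bounded[OF T(2)] by blast
  \<comment> \<open>With this many steps each one is shorter than \<open>\<epsilon> / 2\<close>, so
    the diagonals in the ladder stay below \<open>\<epsilon>\<close>.\<close>
  obtain N :: nat where N: "2 * R / \<epsilon> < N" using reals_Archimedean2 by blast
  then have N0: "N > 0" using R[OF x0] \<epsilon>(1) by (metis dist_self divide_nonneg_pos gr0I
        mult_nonneg_nonneg not_less of_nat_0 zero_le_numeral)
  define pt where "pt x k = x0 + (real k / N) *\<^sub>R (x - x0)" for x k
  have pt_T: "pt x k \<in> T" if "x \<in> T" "k \<le> N" for x k
    using convexD_alt[OF T(1) x0 that(1), of "real k / N"] that N0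
    by (simp add: pt_def algebra_simps)
  have d1: "dist (pt x k) (pt x (Suc k)) < \<epsilon> / 2" if "x \<in> T" for x k
  proof -
    have "pt x (Suc k) - pt x k = (1 / N) *\<^sub>R (x - x0)"
      by (simp add: pt_def add_divide_distrib scaleR_add_left)
    then have "dist (pt x k) (pt x (Suc k)) = dist x0 x / N"
      by (metis dist_norm norm_minus_commute norm_scaleR abs_of_nonneg divide_inverse mult.commute mult_1 of_nat_0_le_iff zero_le_divide_1_iff)
    also have "\<dots> \<le> R / N" using R[OF that] by (simp add: divide_right_mono)
    also have "\<dots> < \<epsilon> / 2" using N N0 \<epsilon>(1) by (simp add: field_simps)
    finally show ?thesis .
  qed
  have d2: "dist (pt x k) (pt y k) \<le> dist x y" if "k \<le> N" for x y k
  proof -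
    have "pt x k - pt y k = (real k / N) *\<^sub>R (x - y)"
      by (simp add: pt_def algebra_simps)
    then have "dist (pt x k) (pt y k) = (real k / N) * dist x y"
      by (simp add: dist_norm)
    also have "\<dots> \<le> 1 * dist x y" using that N0 by (intro mult_right_mono) auto
    finally show ?thesis by simp
  qed
  define S where "S x n = (\<Sum>k<n. K (pt x k) (pt x (Suc k)))" for x n
  \<comment> \<open>Induction up the ladder: in each quadrilateral both routes from one corner to
    the opposite one agree with the diagonal, so the two sums differ exactly by the top
    rung.\<close>
  have S: "S y n = S x n + K (pt x n) (pt y n)"
    if "x \<in> T" "y \<in> T" "dist x y < \<epsilon> / 2" "n \<le> N" for x y n
    using that(4)
  proof (induction n)
    case 0
    \<comment> \<open>At three equal points the cocycle identity forces the value 0, which is the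
      degenerate lowest rung.\<close>
    have "K x0 x0 + K x0 x0 = K x0 x0" using K x0 \<epsilon>(1) by simp
    then show ?case by (simp add: S_def pt_def)
  next
    case (Suc n)
    let ?a = "pt x n" and ?b = "pt x (Suc n)" and ?c = "pt y n" and ?d = "pt y (Suc n)"
    have T: "?a \<in> T" "?b \<in> T" "?c \<in> T" "?d \<in> T" using pt_T that Suc.prems by auto
    have 1: "dist ?a ?b < \<epsilon> / 2" "dist ?c ?d < \<epsilon> / 2" using d1 that by auto
    have 2: "dist ?a ?c < \<epsilon> / 2" "dist ?b ?d < \<epsilon> / 2"
      using d2[of n x y] d2[of "Suc n" x y] that Suc.prems by auto
    have 3: "dist ?a ?d < \<epsilon>" using 1 2 dist_triangle[of ?a ?d ?b] by linarith
    have "K ?a ?b + K ?b ?d = K ?a ?d" by (rule K) (use T 1 2 3 \<epsilon>(1) in auto)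
    moreover have "K ?a ?c + K ?c ?d = K ?a ?d" by (rule K) (use T 1 2 3 \<epsilon>(1) in auto)
    ultimately show ?case using Suc by (simp add: S_def algebra_simps)
  qed
  have pt_N: "pt x N = x" for x using N0 by (simp add: pt_def)
  have "primitive_along I T u (\<lambda>x. S x N)"
    unfolding primitive_along_def
  proof (intro ballI exI[of _ "\<epsilon>/4"] conjI)
    fix t x y assume "x \<in> T \<inter> ball t (\<epsilon>/4)" "y \<in> T \<inter> ball t (\<epsilon>/4)"
    then have "x \<in> T" "y \<in> T" "dist x y < \<epsilon> / 2" using dist_triangle_half_r[of t x "\<epsilon>/2" y] by auto
    from S[OF this order_refl] show "S y N - S x N = I (u x) (u y)" by (simp add: pt_N K_def)
  qed (use \<epsilon> in simp)
  then show ?thesis by blast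
qed (simp add: primitive_along_def)

lemma primitive_along_unique:
  assumes T: "connected T" "s \<in> T" "t \<in> T"
    and "primitive_along I T u \<Psi>" "primitive_along I T u \<Psi>'"
  shows "\<Psi> t - \<Psi> s = \<Psi>' t - \<Psi>' s"
proof -
  have "\<Psi> t - \<Psi>' t = \<Psi> s - \<Psi>' s"
  proof (rule connected_local_const[OF T(1,3,2), of "\<lambda>t. \<Psi> t - \<Psi>' t"], intro ballI)
    fix a assume a: "a \<in> T"
    obtain \<epsilon> where \<epsilon>: "\<epsilon> > 0" "\<And>x y. x \<in> T \<inter> ball a \<epsilon> \<Longrightarrow> y \<in> T \<inter> ball a \<epsilon> \<Longrightarrow> \<Psi> y - \<Psi> x = I (u x) (u y)"
      using assms(4) a unfolding primitive_along_def by meson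
    obtain \<epsilon>' where \<epsilon>': "\<epsilon>' > 0" "\<And>x y. x \<in> T \<inter> ball a \<epsilon>' \<Longrightarrow> y \<in> T \<inter> ball a \<epsilon>' \<Longrightarrow> \<Psi>' y - \<Psi>' x = I (u x) (u y)"
      using assms(5) a unfolding primitive_along_def by meson
    show "\<forall>\<^sub>F b in at a within T. \<Psi> a - \<Psi>' a = \<Psi> b - \<Psi>' b"
      unfolding eventually_at
    proof (intro exI[of _ "min \<epsilon> \<epsilon>'"] conjI ballI impI)
      fix b assume "b \<in> T" "b \<noteq> a \<and> dist b a < min \<epsilon> \<epsilon>'"
      then have "\<Psi> b - \<Psi> a = \<Psi>' b - \<Psi>' a"
        using \<epsilon>(2)[of a b] \<epsilon>'(2)[of a b] a \<epsilon>(1) \<epsilon>'(1) by (simp add: dist_commute)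
      then show "\<Psi> a - \<Psi>' a = \<Psi> b - \<Psi>' b" by (simp add: algebra_simps)
    qed (use \<epsilon>(1) \<epsilon>'(1) in simp)
  qed
  then show ?thesis by (simp add: algebra_simps)
qed

lemma primitive_along_compose:
  assumes \<Psi>: "primitive_along I T u \<Psi>" and v: "continuous_on T' v" "v ` T' \<subseteq> T"
    and w: "\<And>t. t \<in> T' \<Longrightarrow> w t = u (v t)"
  shows "primitive_along I T' w (\<Psi> \<circ> v)"
  unfolding primitive_along_def
proof
  fix t assume t: "t \<in> T'"
  then have "v t \<in> T" using v(2) by blast
  then obtain \<epsilon> where \<epsilon>: "\<epsilon> > 0" "\<And>x y. x \<in> T \<inter> ball (v t) \<epsilon> \<Longrightarrow> y \<in> T \<inter> ball (v t) \<epsilon> \<Longrightarrow> \<Psi> y - \<Psi> x = I (u x) (u y)"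
    using \<Psi> unfolding primitive_along_def by meson
  obtain \<eta> where \<eta>: "\<eta> > 0" "\<And>x. x \<in> T' \<Longrightarrow> dist x t < \<eta> \<Longrightarrow> dist (v x) (v t) < \<epsilon>"
    using v(1) t \<epsilon>(1) unfolding continuous_on_iff by meson
  have near: "dist (v t) (v x) < \<epsilon>" if "x \<in> T'" "dist t x < \<eta>" for x
    using \<eta>(2)[of x] that by (simp add: dist_commute)
  show "\<exists>\<epsilon>>0. \<forall>x\<in>T' \<inter> ball t \<epsilon>. \<forall>y\<in>T' \<inter> ball t \<epsilon>. (\<Psi> \<circ> v) y - (\<Psi> \<circ> v) x = I (w x) (w y)"
  proof (intro exI[of _ \<eta>] conjI ballI)
    fix x y assume "x \<in> T' \<inter> ball t \<eta>" "y \<in> T' \<inter> ball t \<eta>"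
    then have "v x \<in> T \<inter> ball (v t) \<epsilon>" "v y \<in> T \<inter> ball (v t) \<epsilon>" "w x = u (v x)" "w y = u (v y)"
      using near v(2) w by auto
    then show "(\<Psi> \<circ> v) y - (\<Psi> \<circ> v) x = I (w x) (w y)" using \<epsilon>(2) by simp
  qed (rule \<eta>(1))
qed

section \<open>Integrals over segments\<close>

text \<open>By \<open>primitive_along_unique\<close> the increment does not depend on the chosen
  \<open>P\<close>; by \<open>primitive_along_exists\<close> there is one whenever the segment lies
  in the domain of the cocycle.\<close>

definition segment_integral :: "('a \<Rightarrow> 'a \<Rightarrow> 'b::ab_group_add) \<Rightarrow> 'a::euclidean_space \<Rightarrow> 'a \<Rightarrow> 'b" where
  "segment_integral I p q =
     (let P = SOME P. primitive_along I {0..1} (linepath p q) P in P 1 - P 0)"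

text \<open>The segment can be read off from a primitive along another parametrization:
  \<open>u\<close> is the identity of a convex set or runs along the boundary curve, and
  \<open>v\<close> expresses the segment in the parameters of \<open>u\<close>.\<close>

lemma segment_integral_eq:
  assumes "primitive_along I T u \<Psi>" "continuous_on {0..1} v" "v ` {0..1} \<subseteq> T"
    and "\<And>t. t \<in> {0..1} \<Longrightarrow> u (v t) = linepath p q t"
  shows "segment_integral I p q = \<Psi> (v 1) - \<Psi> (v 0)"
proof -
  have *: "primitive_along I {0..1} (linepath p q) (\<Psi> \<circ> v)"
    using assms by (intro primitive_along_compose) auto
  then have "primitive_along I {0..1} (linepath p q) (SOME P. primitive_along I {0..1} (linepath p q) P)"
    by (rule someI[of "primitive_along I {0..1} (linepath p q)"])
  from primitive_along_unique[OF _ _ _ this *, of 0 1] show ?thesis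
    by (simp add: segment_integral_def Let_def)
qed

text \<open>One primitive on the whole convex set serves all segments in it, so the integrals around
  a triangle add up to zero.\<close>

lemma segment_integral_in_convex:
  assumes K: "convex K" "compact K" "K \<subseteq> X" and I: "cocycle_on X I \<delta>"
  obtains \<Psi> where "\<And>p q. p \<in> K \<Longrightarrow> q \<in> K \<Longrightarrow> segment_integral I p q = \<Psi> q - \<Psi> p"
proof -
  obtain \<Psi> where \<Psi>: "primitive_along I K (\<lambda>x. x) \<Psi>"
    using primitive_along_exists[OF K(1,2) continuous_on_id _ I] K(3) by auto
  show ?thesis
  proof (rule that)
    fix p q assume "p \<in> K" "q \<in> K"
    then have "linepath p q ` {0..1} \<subseteq> K"
      using K(1) closed_segment_subset by (simp add: linepath_image_01)
    from segment_integral_eq[OF \<Psi> continuous_on_linepath this, where p = p and q = q]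
    show "segment_integral I p q = \<Psi> q - \<Psi> p" by (simp add: linepath_0' linepath_1')
  qed
qed

lemma segment_integral_flip:
  assumes "closed_segment p q \<subseteq> X" "cocycle_on X I \<delta>"
  shows "segment_integral I q p = - segment_integral I p q"
proof -
  obtain \<Psi> where "\<And>a b. a \<in> closed_segment p q \<Longrightarrow> b \<in> closed_segment p q \<Longrightarrow> segment_integral I a b = \<Psi> b - \<Psi> a"
    using segment_integral_in_convex[OF _ _ assms] by (metis compact_segment convex_closed_segment)
  then show ?thesis by simp
qed

text \<open>Near each parameter \<open>\<Psi>\<close> equals \<open>\<Phi> \<circ> \<Gamma>\<close>
  plus a constant for a genuine primitive \<open>\<Phi>\<close>, so the fundamental theorem of
  calculus applies off finitely many points. Differentiability comes from \<open>\<Gamma>\<close>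
  alone; its lift \<open>\<gamma>\<close> to \<open>M\<close> is just continuous.\<close>

lemma primitive_along_has_integral:
  fixes \<Gamma> :: "real \<Rightarrow> 'c::real_normed_vector" and \<omega> :: "'c \<Rightarrow> 'c \<Rightarrow> 'b::banach"
  assumes \<Psi>: "primitive_along I {r..s} \<gamma> \<Psi>" and rs: "r \<le> s"
    and \<Gamma>: "\<Gamma> piecewise_C1_differentiable_on {r..s}" "\<And>t. t \<in> {r..s} \<Longrightarrow> \<Gamma> t = h (\<gamma> t)"
    and \<gamma>: "continuous_on {r..s} \<gamma>" "\<gamma> ` {r..s} \<subseteq> M"
    and I: "cocycle_on M I \<delta>" "\<And>x. x \<in> M \<Longrightarrow> \<exists>\<Phi>. (\<Phi> has_derivative \<omega> (h x)) (at (h x)) \<and>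
        (\<forall>y\<in>M. dist x y < \<delta> \<longrightarrow> I x y = \<Phi> (h y) - \<Phi> (h x))"
  shows "((\<lambda>t. \<omega> (\<Gamma> t) (vector_derivative \<Gamma> (at t within {r..s}))) has_integral (\<Psi> s - \<Psi> r)) {r..s}"
proof -
  obtain S D where S: "finite S" "\<And>t. t \<in> {r..s} - S \<Longrightarrow> (\<Gamma> has_vector_derivative D t) (at t)"
    and cont: "continuous_on {r..s} \<Gamma>"
    using \<Gamma>(1) unfolding piecewise_C1_differentiable_on_def C1_differentiable_on_def by blast
  have \<delta>: "\<delta> > 0" using I(1) by (simp add: cocycle_on_def)
  have local: "\<exists>\<Phi> \<epsilon>. \<epsilon> > 0 \<and> (\<Phi> has_derivative \<omega> (\<Gamma> t)) (at (\<Gamma> t)) \<and>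
      (\<forall>x\<in>{r..s}. dist x t < \<epsilon> \<longrightarrow> \<Phi> (\<Gamma> x) + (\<Psi> t - \<Phi> (\<Gamma> t)) = \<Psi> x)" if t: "t \<in> {r..s}" for t
  proof -
    have "\<gamma> t \<in> M" using \<gamma>(2) t by blast
    from I(2)[OF this] obtain \<Phi> where \<Phi>: "(\<Phi> has_derivative \<omega> (h (\<gamma> t))) (at (h (\<gamma> t)))"
      "\<And>y. y \<in> M \<Longrightarrow> dist (\<gamma> t) y < \<delta> \<Longrightarrow> I (\<gamma> t) y = \<Phi> (h y) - \<Phi> (h (\<gamma> t))" by blast
    obtain \<epsilon> where \<epsilon>: "\<epsilon> > 0" "\<And>x y. x \<in> {r..s} \<inter> ball t \<epsilon> \<Longrightarrow> y \<in> {r..s} \<inter> ball t \<epsilon> \<Longrightarrow> \<Psi> y - \<Psi> x = I (\<gamma> x) (\<gamma> y)"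
      using \<Psi> t unfolding primitive_along_def by meson
    obtain \<eta> where \<eta>: "\<eta> > 0" "\<And>x. x \<in> {r..s} \<Longrightarrow> dist x t < \<eta> \<Longrightarrow> dist (\<gamma> x) (\<gamma> t) < \<delta>"
      using \<gamma>(1) t \<delta> unfolding continuous_on_iff by meson
    have "\<Phi> (\<Gamma> x) + (\<Psi> t - \<Phi> (\<Gamma> t)) = \<Psi> x" if x: "x \<in> {r..s}" "dist x t < min \<epsilon> \<eta>" for x
    proof -
      have "\<Psi> x - \<Psi> t = I (\<gamma> t) (\<gamma> x)" using \<epsilon> x t by (intro \<epsilon>(2)) (auto simp: dist_commute)
      also have "\<dots> = \<Phi> (h (\<gamma> x)) - \<Phi> (h (\<gamma> t))"
      proof (rule \<Phi>(2))
        show "\<gamma> x \<in> M" using \<gamma>(2) x(1) by blast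
        show "dist (\<gamma> t) (\<gamma> x) < \<delta>" using \<eta>(2)[OF x(1)] x(2) by (simp add: dist_commute)
      qed
      finally show ?thesis using \<Gamma>(2) t x by (simp add: algebra_simps)
    qed
    then show ?thesis using \<Phi>(1) \<epsilon>(1) \<eta>(1) \<Gamma>(2)[OF t] by (metis min_less_iff_conj)
  qed
  show ?thesis
  proof (rule fundamental_theorem_of_calculus_interior_strong[OF S(1) rs])
    show "continuous_on {r..s} \<Psi>"
      unfolding continuous_on_eq_continuous_within
    proof
      fix t assume t: "t \<in> {r..s}"
      from local[OF t] obtain \<Phi> \<epsilon> where l: "\<epsilon> > 0" "(\<Phi> has_derivative \<omega> (\<Gamma> t)) (at (\<Gamma> t))"
        "\<forall>x\<in>{r..s}. dist x t < \<epsilon> \<longrightarrow> \<Phi> (\<Gamma> x) + (\<Psi> t - \<Phi> (\<Gamma> t)) = \<Psi> x" by blast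
      have "continuous (at t within {r..s}) (\<lambda>x. \<Phi> (\<Gamma> x) + (\<Psi> t - \<Phi> (\<Gamma> t)))"
      proof (intro continuous_intros)
        have "isCont \<Phi> (\<Gamma> t)" using l(2) by (rule has_derivative_continuous)
        moreover have "continuous (at t within {r..s}) \<Gamma>"
          using cont t continuous_on_eq_continuous_within by blast
        ultimately show "continuous (at t within {r..s}) (\<lambda>x. \<Phi> (\<Gamma> x))"
          by (rule continuous_within_compose3)
      qed
      then show "continuous (at t within {r..s}) \<Psi>"
        by (rule continuous_transform_within[OF _ l(1) t]) (use l(3) in blast)
    qed
    fix t assume t: "t \<in> {r<..<s} - S"
    then have t': "t \<in> {r..s}" by auto
    from local[OF t'] obtain \<Phi> \<epsilon> where l: "\<epsilon> > 0" "(\<Phi> has_derivative \<omega> (\<Gamma> t)) (at (\<Gamma> t))"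
      "\<forall>x\<in>{r..s}. dist x t < \<epsilon> \<longrightarrow> \<Phi> (\<Gamma> x) + (\<Psi> t - \<Phi> (\<Gamma> t)) = \<Psi> x" by blast
    have D: "(\<Gamma> has_vector_derivative D t) (at t)" using S(2) t by auto
    have vd: "vector_derivative \<Gamma> (at t within {r..s}) = D t"
      using t has_vector_derivative_at_within[OF D]
      by (intro vector_derivative_within_cbox[where 'a='c, unfolded box_real]) auto
    have "((\<Phi> \<circ> \<Gamma>) has_vector_derivative \<omega> (\<Gamma> t) (D t)) (at t)"
      using vector_derivative_diff_chain_within[of \<Gamma> "D t" t UNIV \<Phi> "\<omega> (\<Gamma> t)"] D l(2) has_derivative_at_withinI by blast
    then have "((\<lambda>x. \<Phi> (\<Gamma> x) + (\<Psi> t - \<Phi> (\<Gamma> t))) has_vector_derivative \<omega> (\<Gamma> t) (D t)) (at t)"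
      by (simp add: has_vector_derivative_add_const o_def)
    moreover have "t \<in> {r<..<s}" using t by simp
    moreover have "open {r<..<s}" by simp
    ultimately have "((\<lambda>x. \<Phi> (\<Gamma> x) + (\<Psi> t - \<Phi> (\<Gamma> t))) has_vector_derivative \<omega> (\<Gamma> t) (D t)) (at t within {r<..<s})"
      using has_vector_derivative_at_within by blast
    then have "(\<Psi> has_vector_derivative \<omega> (\<Gamma> t) (D t)) (at t within {r<..<s})"
      unfolding has_vector_derivative_def
      by (rule has_derivative_transform_within[OF _ l(1) \<open>t \<in> {r<..<s}\<close>]) (use l(3) in auto)
    then show "(\<Psi> has_vector_derivative \<omega> (\<Gamma> t) (vector_derivative \<Gamma> (at t within {r..s}))) (at t)"
      using at_within_open[OF \<open>t \<in> {r<..<s}\<close> \<open>open {r<..<s}\<close>] vd by simp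
  qed
qed

section \<open>Subsegments of a segment\<close>

lemma linepath_linepath:
  "linepath (linepath a b x) (linepath a b y) w = linepath a b (linepath x y w)"
  by (simp add: linepath_def algebra_simps)

lemma closed_segment_linepath:
  assumes "x \<le> y"
  shows "closed_segment (linepath a b x) (linepath a b y) = linepath a b ` {x..y}"
proof -
  have "closed_segment (linepath a b x) (linepath a b y) = linepath a b ` linepath x y ` {0..1}"
    by (simp add: linepath_image_01[symmetric] linepath_linepath image_image)
  also have "linepath x y ` {0..1} = {x..y}"
    using assms by (simp add: linepath_image_01 closed_segment_eq_real_ivl)
  finally show ?thesis .
qed

lemma inj_linepath:
  fixes a b :: "'a::real_normed_vector"
  assumes "a \<noteq> b"
  shows "inj (linepath a b)"
proof (rule injI)
  fix x y assume "linepath a b x = linepath a b y"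
  then have "(x - y) *\<^sub>R (b - a) = 0" by (simp add: linepath_def algebra_simps)
  then show "x = y" using assms by simp
qed

lemma open_segment_linepath:
  fixes a b :: "'a::real_normed_vector"
  assumes "x \<le> y" "a \<noteq> b"
  shows "open_segment (linepath a b x) (linepath a b y) = linepath a b ` {x<..<y}"
proof -
  have "{x<..<y} = {x..y} - {x, y}" by auto
  then have "linepath a b ` {x<..<y} = linepath a b ` {x..y} - {linepath a b x, linepath a b y}"
    using inj_linepath[OF assms(2)] by (simp add: image_set_diff)
  then show ?thesis using assms(1) by (simp add: open_segment_def closed_segment_linepath)
qed

section \<open>Cancellation over coherently oriented triangles\<close>

text \<open>Disjointness of the sets \<open>ori T\<close> turns the sum over triangles into a sum
  over directed edges. On the edges present in both directions, reversal shows that the sum is its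
  own negative.\<close>

lemma sum_unpaired_edges_eq_0:
  fixes K :: "'a \<Rightarrow> 'a \<Rightarrow> complex"
  assumes fin: "finite \<T>"
    and tri: "\<And>T. T \<in> \<T> \<Longrightarrow> \<exists>a b c. distinct [a, b, c] \<and> ori T = {(a, b), (b, c), (c, a)} \<and>
                K a b + K b c + K c a = 0"
    and disj: "\<And>T T'. T \<in> \<T> \<Longrightarrow> T' \<in> \<T> \<Longrightarrow> T \<noteq> T' \<Longrightarrow> ori T \<inter> ori T' = {}"
    and anti: "\<And>a b. (a, b) \<in> \<Union>(ori ` \<T>) \<Longrightarrow> K b a = - K a b"
  shows "(\<Sum>(a, b)\<in>{(a, b) \<in> \<Union>(ori ` \<T>). (b, a) \<notin> \<Union>(ori ` \<T>)}. K a b) = 0"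
proof -
  define E where "E = \<Union>(ori ` \<T>)"
  define k where "k = (\<lambda>(a, b). K a b)"
  have fin_ori: "finite (ori T)" if "T \<in> \<T>" for T
  proof -
    obtain a b c where "ori T = {(a, b), (b, c), (c, a)}" using tri[OF \<open>T \<in> \<T>\<close>] by blast
    then show ?thesis by simp
  qed
  then have finE: "finite E" using fin by (auto simp: E_def)
  have "sum k (ori T) = 0" if "T \<in> \<T>" for T
  proof -
    obtain a b c where "distinct [a, b, c]" "ori T = {(a, b), (b, c), (c, a)}" "K a b + K b c + K c a = 0"
      using tri[OF \<open>T \<in> \<T>\<close>] by blast
    then show ?thesis by (auto simp: k_def add.assoc)
  qed
  then have sumE: "sum k E = 0"
    unfolding E_def using fin fin_ori disj by (subst sum.UNION_disjoint) auto
  define P where "P = {(a, b) \<in> E. (b, a) \<in> E}"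
  have "sum k P = (\<Sum>p\<in>P. k (prod.swap p))"
    by (rule sum.reindex_bij_witness[of _ prod.swap prod.swap]) (auto simp: P_def)
  also have "\<dots> = (\<Sum>p\<in>P. - k p)"
    using anti by (intro sum.cong) (auto simp: P_def k_def E_def)
  finally have "sum k P = 0" by (simp add: sum_negf)
  moreover have "E = P \<union> {(a, b) \<in> E. (b, a) \<notin> E}" "P \<inter> {(a, b) \<in> E. (b, a) \<notin> E} = {}"
    by (auto simp: P_def)
  ultimately have "sum k E = sum k {(a, b) \<in> E. (b, a) \<notin> E}"
    using finE sum.union_disjoint[of P "{(a, b) \<in> E. (b, a) \<notin> E}" k]
    by (metis (no_types, lifting) add_0 finite_Un)
  then show ?thesis using sumE by (simp add: k_def E_def)
qed

section \<open>Closed curves cut open along a segment\<close>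

text \<open>Of two disjoint pieces at most one contains \<open>p\<close>. The point to be avoided is
  the base point of the closed curve, which has two parameters.\<close>

lemma segment_in_punctured_segment:
  fixes a b :: "'a::real_normed_vector"
  assumes "a \<noteq> b"
  obtains x y where "0 < x" "x < y" "y < 1" "p \<notin> closed_segment (linepath a b x) (linepath a b y)"
proof (cases "p \<in> linepath a b ` {1/5..2/5}")
  case True
  then have "p \<notin> linepath a b ` {3/5..4/5}" using inj_linepath[OF assms] by (auto dest: injD)
  then show ?thesis using that[of "3/5" "4/5"] by (simp add: closed_segment_linepath)
next
  case False
  then show ?thesis using that[of "1/5" "2/5"] by (simp add: closed_segment_linepath)
qed

text \<open>By compactness \<open>\<gamma>\<close> is a homeomorphism from the parameters over the
  segment onto the segment. Its inverse injects a segment continuously into the real line, so its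
  image is an interval: the curve runs through the segment in one uninterrupted pass.\<close>

lemma preimage_of_segment_in_closed_curve:
  fixes \<gamma> :: "real \<Rightarrow> 'a::euclidean_space"
  assumes cont: "continuous_on {r..s} \<gamma>" and closed: "\<gamma> r = \<gamma> s" and inj: "inj_on \<gamma> {r..<s}"
    and sub: "closed_segment p q \<subseteq> \<gamma> ` {r..s}" and r: "\<gamma> r \<notin> closed_segment p q"
  obtains g where "continuous_on (closed_segment p q) g"
    "g ` closed_segment p q = closed_segment (g p) (g q)" "closed_segment (g p) (g q) \<subseteq> {r<..<s}"
    "\<And>x. x \<in> closed_segment p q \<Longrightarrow> \<gamma> (g x) = x"
    "\<And>t. t \<in> {r..s} \<Longrightarrow> \<gamma> t \<in> closed_segment p q \<Longrightarrow> g (\<gamma> t) = t"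
proof -
  define A where "A = {t \<in> {r..s}. \<gamma> t \<in> closed_segment p q}"
  have A: "A \<subseteq> {r<..<s}"
  proof
    fix t assume "t \<in> A"
    then have "t \<in> {r..s}" "t \<noteq> r" "t \<noteq> s" using r closed by (auto simp: A_def)
    then show "t \<in> {r<..<s}" by simp
  qed
  have "A = {r..s} \<inter> \<gamma> -` closed_segment p q" by (auto simp: A_def)
  then have "closed A" using continuous_closed_preimage[OF cont closed_atLeastAtMost closed_segment] by simp
  moreover have "bounded A"
    by (rule bounded_subset[OF compact_imp_bounded[OF compact_Icc[of r s]]]) (auto simp: A_def)
  ultimately have "compact A" by (simp add: compact_eq_bounded_closed)
  moreover have "\<gamma> ` A = closed_segment p q" using sub by (auto simp: A_def)
  moreover have "inj_on \<gamma> A" by (rule inj_on_subset[OF inj]) (use A in auto)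
  moreover have "continuous_on A \<gamma>" by (rule continuous_on_subset[OF cont]) (auto simp: A_def)
  ultimately obtain g where g: "homeomorphism A (closed_segment p q) \<gamma> g"
    using homeomorphism_compact by metis
  have cg: "continuous_on (closed_segment p q) g" using g by (simp add: homeomorphism_def)
  have ig: "inj_on g (closed_segment p q)"
    using g by (intro inj_on_inverseI[where g = \<gamma>]) (simp add: homeomorphism_def)
  have im: "g ` closed_segment p q = closed_segment (g p) (g q)"
    by (rule continuous_injective_image_segment_1[OF cg ig])
  have gA: "g ` closed_segment p q = A" using g by (simp add: homeomorphism_def)
  show ?thesis
  proof (rule that[OF cg im])
    show "closed_segment (g p) (g q) \<subseteq> {r<..<s}" using im gA A by simp
    show "\<gamma> (g x) = x" if "x \<in> closed_segment p q" for x
      using g that by (simp add: homeomorphism_def)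
    show "g (\<gamma> t) = t" if "t \<in> {r..s}" "\<gamma> t \<in> closed_segment p q" for t
      using g that by (simp add: homeomorphism_def A_def)
  qed
qed

text \<open>The closed curve is cut open along a piece \<open>[m1, m2]\<close> of the segment from \<open>a\<close> to \<open>b\<close>. On the
  remaining arc a primitive is a function \<open>g\<close> of the points of the curve, and the period
  appears where the cut is crossed.\<close>

lemma segment_integral_on_closed_curve:
  fixes \<gamma> :: "real \<Rightarrow> 'a::euclidean_space" and I :: "'a \<Rightarrow> 'a \<Rightarrow> complex"
  assumes rs: "r < s" and cont: "continuous_on {r..s} \<gamma>" and closed: "\<gamma> r = \<gamma> s"
    and inj: "inj_on \<gamma> {r..<s}" and X: "\<gamma> ` {r..s} \<subseteq> X" and I: "cocycle_on X I \<delta>"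
    and \<Psi>: "primitive_along I {r..s} \<gamma> \<Psi>"
    and ab: "a \<noteq> b" "closed_segment a b \<subseteq> \<gamma> ` {r..s}"
  obtains g k where "k = 1 \<or> k = -1" "segment_integral I a b = g b - g a + k * (\<Psi> s - \<Psi> r)"
    "\<And>p q. closed_segment p q \<subseteq> \<gamma> ` {r..s} \<Longrightarrow> closed_segment p q \<inter> open_segment a b = {} \<Longrightarrow>
       segment_integral I p q = g q - g p"
proof -
  define L where "L = s - r"
  \<comment> \<open>Two turns of the curve: the arc that remains after the cut passes through the
    base point and becomes a single parameter interval of \<open>\<gamma>2\<close>.\<close>
  define \<gamma>2 where "\<gamma>2 t = (if t \<le> s then \<gamma> t else \<gamma> (t - L))" for t
  have \<gamma>2_shift: "\<gamma>2 (t + L) = \<gamma> t" if "t \<in> {r..s}" for t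
    using that closed by (auto simp: \<gamma>2_def L_def)
  have img2: "\<gamma>2 ` {r..s+L} \<subseteq> \<gamma> ` {r..s}" by (auto simp: \<gamma>2_def L_def)
  have "{r..s+L} = {r..s} \<union> {s..s+L}" using rs by (auto simp: L_def)
  moreover have "continuous_on ({r..s} \<union> {s..s+L}) \<gamma>2"
    unfolding \<gamma>2_def
  proof (rule continuous_on_cases)
    show "continuous_on {s..s+L} (\<lambda>t. \<gamma> (t - L))"
      by (rule continuous_on_compose2[OF cont]) (auto simp: L_def intro!: continuous_intros)
  qed (use cont closed in \<open>auto simp: L_def\<close>)
  ultimately have cont2: "continuous_on {r..s+L} \<gamma>2" by simp
  obtain \<Psi>2 where \<Psi>2: "primitive_along I {r..s+L} \<gamma>2 \<Psi>2"
    using primitive_along_exists[OF _ _ cont2 _ I] img2 X by (meson compact_Icc convex_real_interval(5) order_trans)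
  \<comment> \<open>Shifting by \<open>L\<close> does not change the curve, so the shifted primitive
    differs from the original by a constant, which is the period.\<close>
  have per: "\<Psi>2 (t + L) = \<Psi>2 t + (\<Psi> s - \<Psi> r)" if t: "t \<in> {r..s}" for t
  proof -
    have 1: "primitive_along I {r..s} \<gamma> (\<Psi>2 \<circ> (\<lambda>t. t))"
      by (rule primitive_along_compose[OF \<Psi>2]) (auto simp: \<gamma>2_def L_def)
    have 2: "primitive_along I {r..s} \<gamma> (\<Psi>2 \<circ> (\<lambda>t. t + L))"
    proof (rule primitive_along_compose[OF \<Psi>2])
      show "continuous_on {r..s} (\<lambda>t. t + L)" by (intro continuous_intros)
      show "(\<lambda>t. t + L) ` {r..s} \<subseteq> {r..s+L}" using rs by (auto simp: L_def)
    qed (rule \<gamma>2_shift[symmetric])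
    have "\<Psi>2 (t + L) - \<Psi>2 (r + L) = \<Psi>2 t - \<Psi>2 r"
      using primitive_along_unique[OF _ _ t 2 1, of r] rs by simp
    moreover have "\<Psi>2 s - \<Psi>2 r = \<Psi> s - \<Psi> r"
      using primitive_along_unique[OF _ _ _ 1 \<Psi>, of r s] rs by simp
    moreover have "r + L = s" by (simp add: L_def)
    ultimately have "\<Psi>2 (t + L) = \<Psi>2 t + (\<Psi>2 s - \<Psi>2 r)" "\<Psi>2 s - \<Psi>2 r = \<Psi> s - \<Psi> r"
      by (simp_all add: diff_eq_eq algebra_simps)
    then show ?thesis by (simp only:)
  qed
  obtain x y where xy: "0 < x" "x < y" "y < 1"
    and r: "\<gamma> r \<notin> closed_segment (linepath a b x) (linepath a b y)"
    using segment_in_punctured_segment[OF ab(1)] by blast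
  define m1 m2 where "m1 = linepath a b x" and "m2 = linepath a b y"
  have ab_lp: "a = linepath a b 0" "b = linepath a b 1" by (simp_all add: linepath_def)
  have seg: "closed_segment m1 m2 = linepath a b ` {x..y}" "open_segment m1 m2 = linepath a b ` {x<..<y}"
    "closed_segment a m1 = linepath a b ` {0..x}" "closed_segment m2 b = linepath a b ` {y..1}"
    "closed_segment a b = linepath a b ` {0..1}" "open_segment a b = linepath a b ` {0<..<1}"
    using xy ab(1) closed_segment_linepath[of x y a b] open_segment_linepath[of x y a b]
      closed_segment_linepath[of 0 x a b] closed_segment_linepath[of y 1 a b]
      closed_segment_linepath[of 0 1 a b] open_segment_linepath[of 0 1 a b]
    by (simp_all add: m1_def m2_def ab_lp[symmetric])
  have m12: "m1 \<noteq> m2" using inj_linepath[OF ab(1)] xy by (auto simp: m1_def m2_def dest: injD)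
  have "closed_segment m1 m2 \<subseteq> \<gamma> ` {r..s}" using ab(2) seg xy by force
  then obtain g where g: "continuous_on (closed_segment m1 m2) g"
    "g ` closed_segment m1 m2 = closed_segment (g m1) (g m2)" "closed_segment (g m1) (g m2) \<subseteq> {r<..<s}"
    "\<And>x. x \<in> closed_segment m1 m2 \<Longrightarrow> \<gamma> (g x) = x"
    "\<And>t. t \<in> {r..s} \<Longrightarrow> \<gamma> t \<in> closed_segment m1 m2 \<Longrightarrow> g (\<gamma> t) = t"
    using preimage_of_segment_in_closed_curve[OF cont closed inj _ r[folded m1_def m2_def]] by metis
  \<comment> \<open>The curve may run from \<open>m1\<close> to \<open>m2\<close> or backwards,
    hence \<open>min\<close> and \<open>max\<close>.\<close>
  define t1 t2 where "t1 = min (g m1) (g m2)" and "t2 = max (g m1) (g m2)"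
  have "g m1 \<noteq> g m2" using g(4)[of m1] g(4)[of m2] m12 by auto
  then have t12: "r < t1" "t1 < t2" "t2 < s"
    using subsetD[OF g(3) ends_in_segment(1)] subsetD[OF g(3) ends_in_segment(2)]
    by (auto simp: t1_def t2_def)
  \<comment> \<open>The remaining arc: from the end of the cut, through the base point, to the start
    of the cut one turn later.\<close>
  define B where "B = {t2..t1+L}"
  have B: "B \<subseteq> {r..s+L}" using t12 by (auto simp: B_def)
  have "inj_on \<gamma>2 B"
  proof (rule inj_onI)
    fix t t' assume *: "t \<in> B" "t' \<in> B" "\<gamma>2 t = \<gamma>2 t'"
    \<comment> \<open>\<open>n\<close> brings parameters of the second turn back to
      \<open>{r..<s}\<close>, where \<open>\<gamma>\<close> is injective.\<close>
    define n where "n t = (if t < s then t else t - L)" for t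
    have "\<gamma>2 t = \<gamma> (n t)" for t using closed by (auto simp: n_def \<gamma>2_def L_def)
    moreover have "n t \<in> {r..<s}" if "t \<in> B" for t
      using that t12 by (auto simp: n_def B_def L_def)
    ultimately have "n t = n t'" using inj * by (metis inj_onD)
    then show "t = t'" using *(1,2) t12 by (auto simp: n_def B_def split: if_splits)
  qed
  moreover have "continuous_on B \<gamma>2" by (rule continuous_on_subset[OF cont2 B])
  ultimately obtain k where k: "homeomorphism B (\<gamma>2 ` B) \<gamma>2 k"
    using homeomorphism_compact[of B \<gamma>2] by (auto simp: B_def)
  have ck: "continuous_on (\<gamma>2 ` B) k" and kB: "k ` \<gamma>2 ` B = B" and k1: "\<And>t. t \<in> B \<Longrightarrow> k (\<gamma>2 t) = t"
    and k2: "\<And>z. z \<in> \<gamma>2 ` B \<Longrightarrow> \<gamma>2 (k z) = z"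
    using k by (auto simp: homeomorphism_def)
  have cover: "z \<in> \<gamma>2 ` B" if z: "z \<in> \<gamma> ` {r..s}" "z \<notin> open_segment m1 m2" for z
  proof -
    obtain t where t: "t \<in> {r..s}" "z = \<gamma> t" using z by blast
    have "\<not> (t1 < t \<and> t < t2)"
    proof
      assume *: "t1 < t \<and> t < t2"
      then have "t \<in> closed_segment (g m1) (g m2)"
        by (auto simp: t1_def t2_def closed_segment_eq_real_ivl)
      then obtain z' where "z' \<in> closed_segment m1 m2" "t = g z'" using g(2) by blast
      then have "z \<in> closed_segment m1 m2" using g(4) t by simp
      moreover have "z \<noteq> m1" "z \<noteq> m2"
        using g(5)[of t] t * by (auto simp: t1_def t2_def)
      ultimately show False using z(2) by (simp add: open_segment_def)
    qed
    then consider "t \<le> t1" | "t2 \<le> t" by linarith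
    then show ?thesis
    proof cases
      case 1
      then have "t + L \<in> B" using t t12 by (auto simp: B_def L_def)
      then show ?thesis using \<gamma>2_shift t by (metis image_eqI)
    next
      case 2
      then have "t \<in> B" using t t12 by (auto simp: B_def L_def)
      moreover have "\<gamma>2 t = z" using t by (simp add: \<gamma>2_def)
      ultimately show ?thesis by blast
    qed
  qed
  define G where "G z = \<Psi>2 (k z)" for z
  have outside: "segment_integral I p q = G q - G p"
    if "closed_segment p q \<subseteq> \<gamma> ` {r..s}" "closed_segment p q \<inter> open_segment m1 m2 = {}" for p q
  proof -
    have "z \<in> \<gamma>2 ` B" if "z \<in> closed_segment p q" for z
      by (rule cover) (use that \<open>closed_segment p q \<subseteq> _\<close> \<open>closed_segment p q \<inter> _ = {}\<close> in blast)+
    then have sub: "linepath p q ` {0..1} \<subseteq> \<gamma>2 ` B"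
      unfolding linepath_image_01 by blast
    have "segment_integral I p q = \<Psi>2 ((k \<circ> linepath p q) 1) - \<Psi>2 ((k \<circ> linepath p q) 0)"
    proof (rule segment_integral_eq[OF \<Psi>2])
      show "continuous_on {0..1} (k \<circ> linepath p q)"
        by (intro continuous_on_compose continuous_on_linepath continuous_on_subset[OF ck sub])
      show "(k \<circ> linepath p q) ` {0..1} \<subseteq> {r..s+L}"
      proof -
        have "k ` linepath p q ` {0..1} \<subseteq> B" using sub kB by blast
        then show ?thesis using B unfolding image_comp by (rule order_trans)
      qed
      show "\<gamma>2 ((k \<circ> linepath p q) t) = linepath p q t" if "t \<in> {0..1}" for t
      proof -
        have "linepath p q t \<in> \<gamma>2 ` B" using sub that by blast
        then show ?thesis unfolding o_apply by (rule k2)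
      qed
    qed
    then show ?thesis by (simp add: G_def linepath_0' linepath_1')
  qed
  have inside: "segment_integral I m1 m2 = \<Psi>2 (g m2) - \<Psi>2 (g m1)"
  proof -
    have "segment_integral I m1 m2 = \<Psi>2 ((g \<circ> linepath m1 m2) 1) - \<Psi>2 ((g \<circ> linepath m1 m2) 0)"
    proof (rule segment_integral_eq[OF \<Psi>2])
      show "continuous_on {0..1} (g \<circ> linepath m1 m2)"
        by (intro continuous_on_compose continuous_on_linepath) (simp add: linepath_image_01 g(1))
      have *: "g (linepath m1 m2 t) \<in> {r<..<s}" "linepath m1 m2 t \<in> closed_segment m1 m2" if "t \<in> {0..1}" for t
        using that g(2,3) linepath_image_01[of m1 m2] by (metis image_eqI subsetD)+
      then show "(g \<circ> linepath m1 m2) ` {0..1} \<subseteq> {r..s+L}" using rs by (force simp: L_def)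
      show "\<gamma>2 ((g \<circ> linepath m1 m2) t) = linepath m1 m2 t" if "t \<in> {0..1}" for t
        using *[OF that] g(4) by (auto simp: \<gamma>2_def)
    qed
    then show ?thesis by (simp add: linepath_0' linepath_1')
  qed
  have "segment_integral I a b = segment_integral I a m1 + segment_integral I m1 m2 + segment_integral I m2 b"
  proof -
    have "closed_segment a b \<subseteq> X" using ab(2) X by blast
    then obtain P where P: "\<And>p q. p \<in> closed_segment a b \<Longrightarrow> q \<in> closed_segment a b \<Longrightarrow> segment_integral I p q = P q - P p"
      using segment_integral_in_convex[OF convex_closed_segment compact_segment _ I] by metis
    have "m1 \<in> closed_segment a b" "m2 \<in> closed_segment a b"
      using xy by (auto simp: seg m1_def m2_def)
    then show ?thesis by (simp add: P)
  qed
  also have "segment_integral I a m1 = G m1 - G a"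
  proof (rule outside)
    show "closed_segment a m1 \<subseteq> \<gamma> ` {r..s}" using ab(2) xy unfolding seg by force
    show "closed_segment a m1 \<inter> open_segment m1 m2 = {}"
      using inj_linepath[OF ab(1)] unfolding seg by (auto dest: injD)
  qed
  also have "segment_integral I m2 b = G b - G m2"
  proof (rule outside)
    show "closed_segment m2 b \<subseteq> \<gamma> ` {r..s}" using ab(2) xy unfolding seg by force
    show "closed_segment m2 b \<inter> open_segment m1 m2 = {}"
      using inj_linepath[OF ab(1)] unfolding seg by (auto dest: injD)
  qed
  \<comment> \<open>Each bracket compares two parameters of the same point, one in the cut and one
    in \<open>B\<close>. The point with parameter \<open>t2\<close> has the same parameter in both,
    the one with \<open>t1\<close> reappears at \<open>t1 + L\<close>; so one bracket is zero and
    the other is the period, its sign given by the direction of the curve.\<close>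
  finally have sum: "segment_integral I a b = G b - G a + (G m1 - \<Psi>2 (g m1)) + (\<Psi>2 (g m2) - G m2)"
    by (simp add: inside)
  have gm: "\<gamma> (g m1) = m1" "\<gamma> (g m2) = m2" using g(4) by simp_all
  have kt: "k (\<gamma> t2) = t2" "k (\<gamma> t1) = t1 + L"
    using k1[of t2] k1[of "t1 + L"] \<gamma>2_shift[of t1] t12 by (auto simp: B_def \<gamma>2_def L_def)
  have "\<exists>e. (e = 1 \<or> e = -1) \<and> segment_integral I a b = G b - G a + e * (\<Psi> s - \<Psi> r)"
  proof (cases "g m1 < g m2")
    case True
    then have "t1 = g m1" "t2 = g m2" by (auto simp: t1_def t2_def)
    then have "G m1 = \<Psi>2 (g m1) + (\<Psi> s - \<Psi> r)" "G m2 = \<Psi>2 (g m2)"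
      using kt gm per[of t1] t12 by (auto simp: G_def)
    then show ?thesis using sum by (intro exI[of _ 1]) simp
  next
    case False
    then have "t1 = g m2" "t2 = g m1" by (auto simp: t1_def t2_def)
    then have "G m2 = \<Psi>2 (g m2) + (\<Psi> s - \<Psi> r)" "G m1 = \<Psi>2 (g m1)"
      using kt gm per[of t1] t12 by (auto simp: G_def)
    then show ?thesis using sum by (intro exI[of _ "-1"]) simp
  qed
  then obtain e where "e = 1 \<or> e = -1" "segment_integral I a b = G b - G a + e * (\<Psi> s - \<Psi> r)" by blast
  moreover have "open_segment m1 m2 \<subseteq> open_segment a b" using xy unfolding seg by force
  ultimately show ?thesis using outside by (intro that[of e G]) blast+
qed

section \<open>Compact surfaces and their boundary\<close>

text \<open>Since \<open>U\<close> lies in the image of the chart, \<open>M\<close> looks like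
  \<open>X\<close> near \<open>Q z0\<close>. An interior point of \<open>X\<close> has a planar
  neighbourhood that \<open>Q\<close> carries into \<open>M\<close>. Conversely, a Euclidean
  neighbourhood in \<open>M\<close> is carried back injectively into the plane, and by invariance of
  domain its image is an open set around \<open>z0\<close> inside \<open>X\<close>.\<close>

lemma surface_boundary_chart:
  fixes Q :: "complex \<Rightarrow> 'a::euclidean_space"
  assumes X: "compact X" and Q: "continuous_on X Q" "inj_on Q X" "Q ` X \<subseteq> M"
    and z0: "z0 \<in> X" and U: "openin (top_of_set M) U" "Q z0 \<in> U" "U \<subseteq> Q ` X"
  shows "Q z0 \<in> surface_boundary M \<longleftrightarrow> z0 \<notin> interior X"
proof
  obtain g where g: "homeomorphism X (Q ` X) Q g"
    using homeomorphism_compact[OF X Q(1) refl Q(2)] by blast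
  have gQ: "g (Q z) = z" if "z \<in> X" for z using g that by (simp add: homeomorphism_def)
  have UM: "U \<subseteq> M" using U(1) openin_imp_subset by blast
  show "z0 \<notin> interior X" if bd: "Q z0 \<in> surface_boundary M"
  proof
    assume z: "z0 \<in> interior X"
    obtain O' where O': "open O'" "U = M \<inter> O'" using U(1) unfolding openin_open by blast
    define N where "N = interior X \<inter> Q -` O'"
    have "open N" unfolding N_def
      by (rule continuous_open_preimage[OF continuous_on_subset[OF Q(1) interior_subset] open_interior O'(1)])
    have NX: "N \<subseteq> X" unfolding N_def using interior_subset[of X] by blast
    then have "openin (top_of_set X) N" using \<open>open N\<close> by (simp add: open_subset)
    then have "openin (top_of_set (Q ` X)) (Q ` N)" by (rule homeomorphism_imp_open_map[OF g])
    then obtain W where W: "open W" "Q ` N = Q ` X \<inter> W" unfolding openin_open by blast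
    have "A = U \<inter> W" if "A = B \<inter> W" "A \<subseteq> U" "U \<subseteq> B" for A B using that by blast
    moreover have "Q ` N \<subseteq> U" using NX Q(3) O'(2) by (auto simp: N_def)
    ultimately have "Q ` N = U \<inter> W" using W(2) U(3) by metis
    then have "openin (top_of_set M) (Q ` N)" using U(1) W(1) by (simp add: openin_Int_open)
    moreover have "homeomorphism N (Q ` N) Q g"
      by (rule homeomorphism_of_subsets[OF g NX]) (use NX in auto)
    then have "Q ` N homeomorphic N" using homeomorphic_def homeomorphic_sym by blast
    moreover have "Q z0 \<in> Q ` N" using z U(2) O' by (auto simp: N_def)
    ultimately show False using bd \<open>open N\<close> unfolding surface_boundary_def by blast
  qed
  show "Q z0 \<in> surface_boundary M" if z: "z0 \<notin> interior X"
  proof (rule ccontr)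
    assume "Q z0 \<notin> surface_boundary M"
    then obtain U' V where U': "Q z0 \<in> U'" "openin (top_of_set M) U'" "open (V :: complex set)" "U' homeomorphic V"
      using U(2) UM unfolding surface_boundary_def by blast
    then obtain \<phi> \<theta> where h: "homeomorphism U' V \<phi> \<theta>" unfolding homeomorphic_def by blast
    define N where "N = \<phi> ` (U \<inter> U')"
    have "openin (top_of_set U') (U \<inter> U')"
      using U(1) UM U'(2) by (meson Int_lower2 openin_Int openin_imp_subset openin_subset_trans)
    then have "openin (top_of_set V) N" unfolding N_def by (rule homeomorphism_imp_open_map[OF h])
    then have oN: "open N" using U'(3) openin_open_eq by blast
    have h1: "\<theta> (\<phi> y) = y" if "y \<in> U'" for y using homeomorphism_apply1[OF h that] .
    have NV: "N \<subseteq> V" using homeomorphism_image1[OF h] unfolding N_def by blast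
    have chiN: "\<theta> ` N = U \<inter> U'" unfolding N_def image_image using h1 by auto
    have gU: "continuous_on (U \<inter> U') g"
      by (rule continuous_on_subset[OF homeomorphism_cont2[OF g]]) (use U(3) in blast)
    have "continuous_on N \<theta>" by (rule continuous_on_subset[OF homeomorphism_cont2[OF h] NV])
    then have c: "continuous_on N (g \<circ> \<theta>)" using gU by (intro continuous_on_compose) (simp_all only: chiN)
    have i: "inj_on (g \<circ> \<theta>) N"
    proof (rule comp_inj_on)
      show "inj_on \<theta> N"
        by (rule inj_on_inverseI[where g = \<phi>]) (rule homeomorphism_apply2[OF h subsetD[OF NV]])
      show "inj_on g (\<theta> ` N)"
        unfolding chiN
        by (rule inj_on_inverseI[where g = Q]) (rule homeomorphism_apply2[OF g], use U(3) in blast)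
    qed
    have "open ((g \<circ> \<theta>) ` N)" by (rule invariance_of_domain[OF c oN i])
    moreover have "(g \<circ> \<theta>) ` N = g ` (U \<inter> U')" unfolding image_comp[symmetric] chiN ..
    moreover have "g ` (U \<inter> U') \<subseteq> X" using U(3) gQ by auto
    moreover have "z0 \<in> g ` (U \<inter> U')" using gQ[OF z0] U(2) U'(1) by (metis IntI image_eqI)
    ultimately show False using z by (metis interiorI)
  qed
qed

section \<open>Bounds on affine dimension\<close>

text \<open>Near one of its points the relative interior of \<open>S\<close> is open in the affine
  hull and injects continuously into the plane. This excludes simplices with more than three
  vertices.\<close>

lemma compact_surface_aff_dim_le_2:
  assumes M: "compact_surface M" and S: "convex S" "S \<subseteq> M"
  shows "aff_dim S \<le> 2"
proof (cases "S = {}")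
  case False
  then obtain x where x: "x \<in> rel_interior S" using S(1) rel_interior_eq_empty by blast
  then have "x \<in> M" using S(2) rel_interior_subset by blast
  then obtain U V where U: "x \<in> U" "openin (top_of_set M) U" and hom: "U homeomorphic (V :: complex set)"
    using M unfolding compact_surface_def by meson
  obtain \<phi> \<theta> where h: "homeomorphism U V \<phi> \<theta>" using hom unfolding homeomorphic_def by blast
  obtain W where W: "open W" "U = M \<inter> W" using U(2) unfolding openin_open by blast
  have rS: "rel_interior S \<subseteq> M" using S(2) rel_interior_subset by blast
  have "aff_dim (affine hull S) \<le> aff_dim (UNIV :: complex set)"
  proof (rule invariance_of_dimension_affine_sets)
    show "openin (top_of_set (affine hull S)) (rel_interior S \<inter> W)"
      by (intro openin_Int_open openin_rel_interior W)
    have sub: "rel_interior S \<inter> W \<subseteq> U" using rS W(2) by blast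
    show "continuous_on (rel_interior S \<inter> W) \<phi>"
      by (rule continuous_on_subset[OF homeomorphism_cont1[OF h] sub])
    show "inj_on \<phi> (rel_interior S \<inter> W)"
      by (rule inj_on_inverseI[where g = \<theta>]) (rule homeomorphism_apply1[OF h subsetD[OF sub]])
    show "rel_interior S \<inter> W \<noteq> {}" using x U(1) W(2) by blast
  qed auto
  then show ?thesis by simp
qed simp

text \<open>A neighbourhood in the surface contains an injective continuous image of a nonempty open
  planar set. This is what puts a triangle next to every edge.\<close>

lemma compact_surface_open_aff_dim_ge_2:
  assumes M: "compact_surface M" and U: "openin (top_of_set M) U" "x \<in> U" and A: "affine A" "U \<subseteq> A"
  shows "aff_dim A \<ge> 2"
proof -
  let ?H = "{z::complex. 0 \<le> Im z}"
  have "x \<in> M" using U openin_imp_subset by blast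
  then obtain U' V where U': "x \<in> U'" "openin (top_of_set M) U'" and V: "openin (top_of_set ?H) V"
    and hom: "U' homeomorphic V"
    using M unfolding compact_surface_def by meson
  obtain \<phi> \<theta> where h: "homeomorphism U' V \<phi> \<theta>" using hom unfolding homeomorphic_def by blast
  have "openin (top_of_set U') (U \<inter> U')"
    using U(1) U'(2) by (meson Int_lower2 openin_Int openin_imp_subset openin_subset_trans)
  then have "openin (top_of_set V) (\<phi> ` (U \<inter> U'))" by (rule homeomorphism_imp_open_map[OF h])
  then have "openin (top_of_set ?H) (\<phi> ` (U \<inter> U'))" using V openin_trans by blast
  then obtain W where W: "open W" "\<phi> ` (U \<inter> U') = ?H \<inter> W" unfolding openin_open by blast
  have w: "\<phi> x \<in> ?H \<inter> W" using U(2) U'(1) W(2) by blast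
  then obtain e where e: "e > 0" "ball (\<phi> x) e \<subseteq> W" using W(1) by (meson IntD2 openE)
  define N where "N = {z. Im z > 0} \<inter> W"
  \<comment> \<open>The image of \<open>x\<close> may lie on the rim of the half-plane; moving up by
    \<open>e/2\<close> gives a point off the rim within the same ball.\<close>
  have "\<phi> x + of_real (e/2) * \<i> \<in> N" using w e by (auto simp: N_def dist_norm norm_mult subset_iff)
  then have ne: "N \<noteq> {}" by blast
  have NH: "N \<subseteq> \<phi> ` (U \<inter> U')" unfolding W(2) by (auto simp: N_def)
  have NV: "N \<subseteq> V" using NH homeomorphism_image1[OF h] by blast
  have "aff_dim (UNIV :: complex set) \<le> aff_dim A"
  proof (rule invariance_of_dimension_affine_sets)
    show "openin (top_of_set UNIV) N"
      using W(1) by (simp add: N_def open_Int open_halfspace_Im_gt)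
    show "continuous_on N \<theta>" by (rule continuous_on_subset[OF homeomorphism_cont2[OF h] NV])
    show "inj_on \<theta> N"
      by (rule inj_on_inverseI[where g = \<phi>]) (rule homeomorphism_apply2[OF h subsetD[OF NV]])
    have "\<theta> ` \<phi> ` (U \<inter> U') \<subseteq> A" using homeomorphism_apply1[OF h] A(2) by auto
    then show "\<theta> \<in> N \<rightarrow> A" using NH by blast
  qed (use A ne in auto)
  then show ?thesis by simp
qed

lemma affine_independent_3D:
  fixes a b c :: "'a::real_vector"
  assumes "\<not> affine_dependent {a, b, c}" "distinct [a, b, c]"
    and eq: "u *\<^sub>R (b - a) + v *\<^sub>R (c - a) = 0"
  shows "u = 0 \<and> v = 0"
proof (rule ccontr)
  assume *: "\<not> (u = 0 \<and> v = 0)"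
  define w where "w = (\<lambda>x. if x = a then - (u + v) else if x = b then u else v)"
  have "sum w {a, b, c} = 0" "(\<Sum>x\<in>{a, b, c}. w x *\<^sub>R x) = 0"
    using assms(2) eq by (auto simp: w_def algebra_simps)
  moreover have "\<exists>x\<in>{a, b, c}. w x \<noteq> 0" using * assms(2) by (auto simp: w_def)
  ultimately have "affine_dependent {a, b, c}"
    by (subst affine_dependent_explicit_finite) auto
  then show False using assms(1) by blast
qed

section \<open>Planar charts of one triangle and of two adjacent triangles\<close>

text \<open>A simplicial complex lists its simplices as bare sets of points, so their vertices have
  to be recovered as extreme points.\<close>

definition vertices :: "'a::real_vector set \<Rightarrow> 'a set" where
  "vertices K = {x. x extreme_point_of K}"

lemma vertices_convex_hull:
  fixes S :: "'a::euclidean_space set"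
  shows "\<not> affine_dependent S \<Longrightarrow> vertices (convex hull S) = S"
  by (simp add: vertices_def extreme_point_of_convex_hull_affine_independent)

text \<open>The affine map that takes 0, 1, \<open>\<i>\<close> to \<open>a\<close>,
  \<open>b\<close>, \<open>c\<close>; the edge from \<open>a\<close> to \<open>b\<close> lies over
  the real axis.\<close>

definition triangle_chart :: "'a::real_vector \<Rightarrow> 'a \<Rightarrow> 'a \<Rightarrow> complex \<Rightarrow> 'a" where
  "triangle_chart a b c z = a + Re z *\<^sub>R (b - a) + Im z *\<^sub>R (c - a)"

definition standard_triangle :: "complex set" where
  "standard_triangle = {z. 0 \<le> Re z \<and> 0 \<le> Im z \<and> Re z + Im z \<le> 1}"

lemma triangle_chart_image: "triangle_chart a b c ` standard_triangle = convex hull {a, b, c}"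
  unfolding convex_hull_3_alt
proof safe
  fix z assume "z \<in> standard_triangle"
  then show "\<exists>u v. triangle_chart a b c z = a + u *\<^sub>R (b - a) + v *\<^sub>R (c - a) \<and> 0 \<le> u \<and> 0 \<le> v \<and> u + v \<le> 1"
    unfolding standard_triangle_def triangle_chart_def by blast
next
  fix u v :: real assume "0 \<le> u" "0 \<le> v" "u + v \<le> 1"
  then show "a + u *\<^sub>R (b - a) + v *\<^sub>R (c - a) \<in> triangle_chart a b c ` standard_triangle"
    by (intro image_eqI[of _ _ "Complex u v"]) (simp_all add: standard_triangle_def triangle_chart_def)
qed

lemma inj_triangle_chart:
  assumes "\<not> affine_dependent {a, b, c}" "distinct [a, b, c]"
  shows "inj (triangle_chart a b c)"
proof (rule injI)
  fix z w assume "triangle_chart a b c z = triangle_chart a b c w"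
  then have "Re z *\<^sub>R (b - a) + Im z *\<^sub>R (c - a) = Re w *\<^sub>R (b - a) + Im w *\<^sub>R (c - a)"
    by (simp add: triangle_chart_def add.assoc)
  moreover have "(Re z - Re w) *\<^sub>R (b - a) + (Im z - Im w) *\<^sub>R (c - a) =
      (Re z *\<^sub>R (b - a) + Im z *\<^sub>R (c - a)) - (Re w *\<^sub>R (b - a) + Im w *\<^sub>R (c - a))"
    by (simp only: scaleR_diff_left add_diff_add)
  ultimately have "(Re z - Re w) *\<^sub>R (b - a) + (Im z - Im w) *\<^sub>R (c - a) = 0" by simp
  from affine_independent_3D[OF assms this] have "Re z = Re w" "Im z = Im w" by linarith+
  then show "z = w" by (rule complex_eqI)
qed

lemma continuous_on_triangle_chart: "continuous_on X (triangle_chart a b c)"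
  for a :: "'a::real_normed_vector"
  unfolding triangle_chart_def by (intro continuous_intros)

lemma compact_standard_triangle: "compact standard_triangle"
proof -
  have eq: "standard_triangle = {z. 0 \<le> Re z} \<inter> {z. 0 \<le> Im z} \<inter> {z. Re z + Im z \<le> 1}"
    by (auto simp: standard_triangle_def)
  have "closed standard_triangle"
    unfolding eq by (intro closed_Int closed_Collect_le continuous_intros)
  moreover have "standard_triangle \<subseteq> cball 0 2"
  proof
    fix z assume "z \<in> standard_triangle"
    then have "\<bar>Re z\<bar> + \<bar>Im z\<bar> \<le> 2" by (simp add: standard_triangle_def)
    then show "z \<in> cball 0 2" using cmod_le[of z] by simp
  qed
  ultimately show ?thesis using bounded_cball bounded_subset compact_eq_bounded_closed by blast
qed

definition double_triangle :: "complex set" where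
  "double_triangle = {z. 0 \<le> Re z \<and> Re z + \<bar>Im z\<bar> \<le> 1}"

text \<open>A fold along the real axis: the upper half follows the triangle \<open>a\<close>,
  \<open>b\<close>, \<open>c\<close>, the lower half the triangle \<open>a\<close>,
  \<open>b\<close>, \<open>d\<close>. Inner points of the common edge thereby lie over interior
  points of \<open>double_triangle\<close>.\<close>

definition double_triangle_chart :: "'a::real_vector \<Rightarrow> 'a \<Rightarrow> 'a \<Rightarrow> 'a \<Rightarrow> complex \<Rightarrow> 'a" where
  "double_triangle_chart a b c d z =
     a + Re z *\<^sub>R (b - a) + max (Im z) 0 *\<^sub>R (c - a) + max (- Im z) 0 *\<^sub>R (d - a)"

lemma double_triangle_chart_upper: "Im z \<ge> 0 \<Longrightarrow> double_triangle_chart a b c d z = triangle_chart a b c z"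
  by (simp add: double_triangle_chart_def triangle_chart_def)

lemma double_triangle_chart_lower: "Im z \<le> 0 \<Longrightarrow> double_triangle_chart a b c d z = triangle_chart a b d (cnj z)"
  by (simp add: double_triangle_chart_def triangle_chart_def)

lemma continuous_on_double_triangle_chart: "continuous_on X (double_triangle_chart a b c d)"
  for a :: "'a::real_normed_vector"
  unfolding double_triangle_chart_def by (intro continuous_intros)

lemma compact_double_triangle: "compact double_triangle"
proof -
  have eq: "double_triangle = {z. 0 \<le> Re z} \<inter> {z. Re z + \<bar>Im z\<bar> \<le> 1}"
    by (auto simp: double_triangle_def)
  have "closed double_triangle"
    unfolding eq by (intro closed_Int closed_Collect_le continuous_intros)
  moreover have "double_triangle \<subseteq> cball 0 2"
  proof
    fix z assume "z \<in> double_triangle"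
    then have "\<bar>Re z\<bar> + \<bar>Im z\<bar> \<le> 2" by (simp add: double_triangle_def)
    then show "z \<in> cball 0 2" using cmod_le[of z] by simp
  qed
  ultimately show ?thesis using bounded_cball bounded_subset compact_eq_bounded_closed by blast
qed

lemma double_triangle_eq: "double_triangle = standard_triangle \<union> cnj ` standard_triangle"
proof
  show "double_triangle \<subseteq> standard_triangle \<union> cnj ` standard_triangle"
  proof
    fix z assume z: "z \<in> double_triangle"
    show "z \<in> standard_triangle \<union> cnj ` standard_triangle"
    proof (cases "Im z \<ge> 0")
      case True
      then show ?thesis using z by (simp add: double_triangle_def standard_triangle_def)
    next
      case False
      then have "cnj z \<in> standard_triangle" using z by (simp add: double_triangle_def standard_triangle_def)
      then have "cnj (cnj z) \<in> cnj ` standard_triangle" by (rule imageI)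
      then show ?thesis by simp
    qed
  qed
qed (auto simp: double_triangle_def standard_triangle_def)

lemma double_triangle_chart_image:
  "double_triangle_chart a b c d ` double_triangle = convex hull {a, b, c} \<union> convex hull {a, b, d}"
proof -
  have "double_triangle_chart a b c d ` standard_triangle = triangle_chart a b c ` standard_triangle"
    by (intro image_cong double_triangle_chart_upper) (simp_all add: standard_triangle_def)
  moreover have "double_triangle_chart a b c d ` cnj ` standard_triangle = triangle_chart a b d ` standard_triangle"
    unfolding image_image
    by (intro image_cong) (simp_all add: standard_triangle_def double_triangle_chart_lower)
  ultimately show ?thesis
    by (simp add: double_triangle_eq image_Un triangle_chart_image)
qed

section \<open>Combinatorics of an oriented triangulated surface\<close>

locale oriented_surface =
  fixes M :: "'a::euclidean_space set" and \<C> :: "'a set set" and ori :: "'a set \<Rightarrow> ('a \<times> 'a) set"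
  assumes surface: "compact_surface M"
    and complex: "simplicial_complex \<C>" and Union: "\<Union>\<C> = M"
    and ori_triangle: "\<And>T. T \<in> \<C> \<Longrightarrow> 2 simplex T \<Longrightarrow>
      \<exists>a b c. T = convex hull {a, b, c} \<and> ori T = {(a, b), (b, c), (c, a)}"
    and ori_disjoint: "\<And>T T'. T \<in> \<C> \<Longrightarrow> T' \<in> \<C> \<Longrightarrow> 2 simplex T \<Longrightarrow> 2 simplex T' \<Longrightarrow> T \<noteq> T' \<Longrightarrow> ori T \<inter> ori T' = {}"
begin

definition triangles :: "'a set set" where
  "triangles = {T \<in> \<C>. 2 simplex T}"

definition edges :: "('a \<times> 'a) set" where
  "edges = \<Union>(ori ` triangles)"

definition unpaired_edges :: "('a \<times> 'a) set" where
  "unpaired_edges = {(a, b) \<in> edges. (b, a) \<notin> edges}"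

text \<open>The open star, taken at arbitrary points and not only at vertices. Since the complex is
  finite, it is a neighbourhood of \<open>x\<close> in \<open>M\<close> that meets only simplices
  containing \<open>x\<close>.\<close>

definition star :: "'a \<Rightarrow> 'a set" where
  "star x = M - \<Union>{K \<in> \<C>. x \<notin> K}"

lemma finite_complex: "finite \<C>" using complex by (simp add: simplicial_complex_def)

lemma finite_triangles: "finite triangles" using finite_complex by (simp add: triangles_def)

lemma
  assumes K: "K \<in> \<C>"
  shows independent_vertices: "\<not> affine_dependent (vertices K)"
    and hull_vertices: "convex hull (vertices K) = K"
proof -
  obtain n where "n simplex K" using complex K unfolding simplicial_complex_def by blast
  then obtain S where S: "\<not> affine_dependent S" "K = convex hull S" unfolding simplex_def by blast
  then have "vertices K = S" by (simp add: vertices_convex_hull)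
  then show "\<not> affine_dependent (vertices K)" "convex hull (vertices K) = K" using S by simp_all
qed

lemma face_in_complex: "K \<in> \<C> \<Longrightarrow> S \<subseteq> vertices K \<Longrightarrow> convex hull S \<in> \<C>"
proof -
  assume K: "K \<in> \<C>" "S \<subseteq> vertices K"
  have "convex hull S face_of convex hull (vertices K)"
    using face_of_convex_hull_affine_independent[OF independent_vertices[OF K(1)]] K(2) by blast
  then show "convex hull S \<in> \<C>"
    using complex K(1) unfolding hull_vertices[OF K(1)] simplicial_complex_def by blast
qed

text \<open>The intersection is a face of both simplices, hence spanned by a subset of either vertex
  set; both subsets consist of its extreme points, so they coincide.\<close>

lemma Int_simplices:
  assumes "K \<in> \<C>" "K' \<in> \<C>"
  shows "K \<inter> K' = convex hull (vertices K \<inter> vertices K')"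
proof
  have "K \<inter> K' face_of convex hull (vertices K)"
    using complex assms unfolding hull_vertices[OF assms(1)] simplicial_complex_def by blast
  then obtain S where S: "S \<subseteq> vertices K" "K \<inter> K' = convex hull S"
    using face_of_convex_hull_affine_independent[OF independent_vertices[OF assms(1)]] by blast
  have "K' \<inter> K face_of convex hull (vertices K')"
    using complex assms unfolding hull_vertices[OF assms(2)] simplicial_complex_def by blast
  then obtain S' where S': "S' \<subseteq> vertices K'" "K' \<inter> K = convex hull S'"
    using face_of_convex_hull_affine_independent[OF independent_vertices[OF assms(2)]] by blast
  have "S = vertices (K \<inter> K')"
    using S affine_independent_subset[OF independent_vertices[OF assms(1)] S(1)] by (simp add: vertices_convex_hull)
  moreover have "S' = vertices (K' \<inter> K)"
    using S' affine_independent_subset[OF independent_vertices[OF assms(2)] S'(1)] by (simp add: vertices_convex_hull)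
  ultimately have "S \<subseteq> vertices K \<inter> vertices K'" using S(1) S'(1) by (simp add: Int_commute)
  then show "K \<inter> K' \<subseteq> convex hull (vertices K \<inter> vertices K')" unfolding S(2) by (rule hull_mono)
  have "convex hull (vertices K \<inter> vertices K') \<subseteq> convex hull (vertices K)"
    "convex hull (vertices K \<inter> vertices K') \<subseteq> convex hull (vertices K')" by (simp_all add: hull_mono)
  then show "convex hull (vertices K \<inter> vertices K') \<subseteq> K \<inter> K'"
    by (simp add: hull_vertices assms)
qed

lemma card_vertices_le_3:
  assumes "K \<in> \<C>"
  shows "card (vertices K) \<le> 3"
proof -
  have "K \<subseteq> M" using Union assms by blast
  moreover have "convex K" using hull_vertices[OF assms] convex_convex_hull by metis
  ultimately have "aff_dim K \<le> 2" using compact_surface_aff_dim_le_2[OF surface] by blast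
  moreover have "aff_dim K = aff_dim (vertices K)" using aff_dim_convex_hull hull_vertices[OF assms] by metis
  ultimately show ?thesis using aff_dim_affine_independent[OF independent_vertices[OF assms]] by linarith
qed

lemma finite_vertices: "K \<in> \<C> \<Longrightarrow> finite (vertices K)"
  by (rule aff_independent_finite[OF independent_vertices])

lemma openin_star: "openin (top_of_set M) (star x)"
proof -
  have "closed K" if "K \<in> \<C>" for K
    using complex that closed_simplex unfolding simplicial_complex_def by blast
  then have "closed (\<Union>{K \<in> \<C>. x \<notin> K})" using finite_complex by (intro closed_Union) auto
  then show ?thesis unfolding star_def Diff_eq by (intro openin_open_Int) (simp add: open_Compl)
qed

lemma star_self: "x \<in> M \<Longrightarrow> x \<in> star x"
  by (auto simp: star_def)

lemma star_simplex:
  assumes "y \<in> star x"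
  obtains K where "K \<in> \<C>" "x \<in> K" "y \<in> K"
  using assms Union unfolding star_def by blast

lemma star_not_subset_segment:
  assumes "x \<in> M"
  shows "\<not> star x \<subseteq> closed_segment a b"
proof
  assume "star x \<subseteq> closed_segment a b"
  then have "star x \<subseteq> affine hull {a, b}"
    using convex_hull_subset_affine_hull unfolding segment_convex_hull by (rule order_trans)
  then have "2 \<le> aff_dim (affine hull {a, b})"
    by (rule compact_surface_open_aff_dim_ge_2[OF surface openin_star star_self[OF assms] affine_affine_hull])
  then show False using aff_dim_2[of a b] by (simp split: if_splits)
qed

lemma triangle_iff: "T \<in> triangles \<longleftrightarrow> T \<in> \<C> \<and> card (vertices T) = 3"
proof
  assume T: "T \<in> triangles"
  then obtain S where S: "\<not> affine_dependent S" "card S = 3" "T = convex hull S"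
    unfolding triangles_def simplex_def by auto
  then show "T \<in> \<C> \<and> card (vertices T) = 3" using T by (simp add: vertices_convex_hull triangles_def)
next
  assume "T \<in> \<C> \<and> card (vertices T) = 3"
  then show "T \<in> triangles" unfolding triangles_def simplex_def
    using independent_vertices hull_vertices by force
qed

lemma triangle_ori:
  assumes T: "T \<in> triangles"
  obtains a b c where "distinct [a, b, c]" "vertices T = {a, b, c}" "ori T = {(a, b), (b, c), (c, a)}"
proof -
  have TC: "T \<in> \<C>" "card (vertices T) = 3" using T by (simp_all add: triangle_iff)
  obtain a b c where abc: "T = convex hull {a, b, c}" "ori T = {(a, b), (b, c), (c, a)}"
    using ori_triangle T unfolding triangles_def by blast
  have "vertices T \<subseteq> {a, b, c}"
    unfolding vertices_def abc(1) using extreme_point_of_convex_hull by blast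
  moreover have c3: "card {a, b, c} \<le> 3" by (simp add: card_insert_if)
  ultimately have v: "vertices T = {a, b, c}" using TC(2) by (intro card_seteq) simp_all
  then have "card (set [a, b, c]) = length [a, b, c]" using TC(2) by simp
  then have "distinct [a, b, c]" by (rule card_distinct)
  then show ?thesis using v abc(2) by (rule that)
qed

lemma edge_triangle:
  assumes "(a, b) \<in> edges"
  obtains T c where "T \<in> triangles" "distinct [a, b, c]" "vertices T = {a, b, c}" "ori T = {(a, b), (b, c), (c, a)}"
proof -
  obtain T where T: "T \<in> triangles" "(a, b) \<in> ori T" using assms by (auto simp: edges_def)
  obtain x y z where xyz: "distinct [x, y, z]" "vertices T = {x, y, z}" "ori T = {(x, y), (y, z), (z, x)}"
    using triangle_ori[OF T(1)] .
  from T(2) xyz(3) consider "a = x" "b = y" | "a = y" "b = z" | "a = z" "b = x" by auto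
  then show ?thesis
  proof cases
    case 1 show ?thesis by (rule that[of T z]) (use T(1) xyz 1 in auto)
  next
    case 2 show ?thesis by (rule that[of T x]) (use T(1) xyz 2 in auto)
  next
    case 3 show ?thesis by (rule that[of T y]) (use T(1) xyz 3 in auto)
  qed
qed

lemma two_vertices_edge:
  assumes "T \<in> triangles" "a \<in> vertices T" "b \<in> vertices T" "a \<noteq> b"
  shows "(a, b) \<in> ori T \<or> (b, a) \<in> ori T"
proof -
  obtain x y z where "distinct [x, y, z]" "vertices T = {x, y, z}" "ori T = {(x, y), (y, z), (z, x)}"
    using triangle_ori[OF assms(1)] .
  then show ?thesis using assms(2-4) by auto
qed

lemma edge_unique_triangle: "T \<in> triangles \<Longrightarrow> T' \<in> triangles \<Longrightarrow> p \<in> ori T \<Longrightarrow> p \<in> ori T' \<Longrightarrow> T = T'"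
  using ori_disjoint[of T T'] by (auto simp: triangles_def)

lemma vertices_segment:
  fixes a b :: 'a
  shows "vertices (closed_segment a b) = {a, b}"
  by (simp add: vertices_convex_hull segment_convex_hull affine_independent_2)

text \<open>\<open>K\<close> meets the segment in the hull of the common vertices, and one endpoint
  alone does not span an inner point.\<close>

lemma simplex_through_segment:
  assumes e: "closed_segment a b \<in> \<C>" and x: "x \<in> open_segment a b" and K: "K \<in> \<C>" "x \<in> K"
  shows "a \<in> vertices K" "b \<in> vertices K"
proof -
  have ab: "x \<noteq> a" "x \<noteq> b" "x \<in> closed_segment a b" using x by (auto simp: open_segment_def)
  have xh: "x \<in> convex hull (vertices K \<inter> {a, b})"
    using Int_simplices[OF K(1) e] K(2) ab(3) by (auto simp: vertices_segment)
  have *: "\<not> vertices K \<inter> {a, b} \<subseteq> {c}" if "x \<noteq> c" for c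
  proof
    assume "vertices K \<inter> {a, b} \<subseteq> {c}"
    then have "x \<in> convex hull {c}" using xh hull_mono by blast
    then show False using that by simp
  qed
  show "a \<in> vertices K" using *[OF ab(2)] by blast
  show "b \<in> vertices K" using *[OF ab(1)] by blast
qed

lemma simplex_two_vertices_cases:
  assumes K: "K \<in> \<C>" "a \<in> vertices K" "b \<in> vertices K" "a \<noteq> b"
  shows "K = closed_segment a b \<or> (K \<in> triangles \<and> ((a, b) \<in> ori K \<or> (b, a) \<in> ori K))"
proof (cases "vertices K = {a, b}")
  case True
  then show ?thesis using hull_vertices[OF K(1)] by (simp add: segment_convex_hull)
next
  case False
  have fin: "finite (vertices K)" by (rule finite_vertices[OF K(1)])
  have "{a, b} \<subset> vertices K" using False K by blast
  then have "card {a, b} < card (vertices K)" by (rule psubset_card_mono[OF fin])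
  then have "card (vertices K) = 3" using card_vertices_le_3[OF K(1)] K(4) by simp
  then have "K \<in> triangles" using K(1) by (simp add: triangle_iff)
  then show ?thesis using two_vertices_edge K by blast
qed

lemma edge_in_complex:
  assumes "(a, b) \<in> edges"
  shows "closed_segment a b \<in> \<C>"
proof -
  obtain T c where T: "T \<in> triangles" "vertices T = {a, b, c}" using edge_triangle[OF assms] by metis
  then show ?thesis
    unfolding segment_convex_hull by (intro face_in_complex[of T]) (auto simp: triangle_iff)
qed

lemma triangle_vertices:
  assumes "T \<in> triangles" "vertices T = {a, b, c}"
  shows "\<not> affine_dependent {a, b, c}" "convex hull {a, b, c} = T" "T \<subseteq> M" "T \<in> \<C>"
  using assms independent_vertices[of T] hull_vertices[of T] Union by (auto simp: triangle_iff)

section \<open>Unpaired edges and the manifold boundary\<close>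

text \<open>A simplex through an inner point of the edge is the edge itself or a triangle on it.
  Such a triangle has the direction \<open>(a, b)\<close>, because \<open>(b, a)\<close> does not
  occur, and only one triangle has it. So the surface near \<open>x\<close> is one triangle with
  \<open>x\<close> on its side.\<close>

lemma unpaired_edge_subset_boundary:
  assumes ab: "(a, b) \<in> unpaired_edges"
  shows "open_segment a b \<subseteq> surface_boundary M"
proof
  fix x assume x: "x \<in> open_segment a b"
  have E: "(a, b) \<in> edges" "(b, a) \<notin> edges" using ab by (auto simp: unpaired_edges_def)
  obtain T c where T: "T \<in> triangles" "distinct [a, b, c]" "vertices T = {a, b, c}" "ori T = {(a, b), (b, c), (c, a)}"
    using edge_triangle[OF E(1)] .
  note Tv = triangle_vertices[OF T(1,3)]
  have seg: "closed_segment a b \<subseteq> T"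
    unfolding Tv(2)[symmetric] segment_convex_hull by (rule hull_mono) blast
  have star: "star x \<subseteq> T"
  proof
    fix y assume "y \<in> star x"
    then obtain K where K: "K \<in> \<C>" "x \<in> K" "y \<in> K" by (rule star_simplex)
    have "K = closed_segment a b \<or> (K \<in> triangles \<and> ((a, b) \<in> ori K \<or> (b, a) \<in> ori K))"
      using simplex_through_segment[OF edge_in_complex[OF E(1)] x K(1,2)] T(2)
      by (intro simplex_two_vertices_cases K(1)) simp_all
    then show "y \<in> T"
    proof
      assume "K = closed_segment a b"
      then show ?thesis using K(3) seg by blast
    next
      assume *: "K \<in> triangles \<and> ((a, b) \<in> ori K \<or> (b, a) \<in> ori K)"
      then have "(a, b) \<in> ori K" using E(2) unfolding edges_def by blast
      then have "K = T" using * T(1,4) by (intro edge_unique_triangle[of K T "(a, b)"]) simp_all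
      then show ?thesis using K(3) by simp
    qed
  qed
  obtain u where u: "0 < u" "u < 1" "x = (1 - u) *\<^sub>R a + u *\<^sub>R b" using x by (auto simp: in_segment)
  define z where "z = complex_of_real u"
  have xz: "x = triangle_chart a b c z"
    using u(3) by (simp add: z_def triangle_chart_def algebra_simps)
  have "triangle_chart a b c z \<in> surface_boundary M \<longleftrightarrow> z \<notin> interior standard_triangle"
  proof (rule surface_boundary_chart[OF compact_standard_triangle continuous_on_triangle_chart])
    show "inj_on (triangle_chart a b c) standard_triangle"
      by (rule inj_on_subset[OF inj_triangle_chart[OF Tv(1) T(2)]]) simp
    show "triangle_chart a b c ` standard_triangle \<subseteq> M"
      unfolding triangle_chart_image Tv(2) by (rule Tv(3))
    show "z \<in> standard_triangle" using u by (simp add: z_def standard_triangle_def)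
    show "star x \<subseteq> triangle_chart a b c ` standard_triangle"
      unfolding triangle_chart_image Tv(2) by (rule star)
    show "triangle_chart a b c z \<in> star x"
      unfolding xz[symmetric] using x seg Tv(3) by (intro star_self) (auto simp: open_segment_def)
  qed (rule openin_star)
  moreover have "z \<notin> interior standard_triangle"
  proof
    assume "z \<in> interior standard_triangle"
    then obtain e where e: "e > 0" "ball z e \<subseteq> standard_triangle" by (auto simp: mem_interior)
    have "z - of_real (e/2) * \<i> \<in> ball z e" using e(1) by (simp add: dist_norm norm_mult)
    then have "z - of_real (e/2) * \<i> \<in> standard_triangle" using e(2) by blast
    then show False using e(1) by (simp add: standard_triangle_def z_def)
  qed
  ultimately show "x \<in> surface_boundary M" using xz by simp
qed

lemma paired_edge_Int:
  assumes T: "T \<in> triangles" "vertices T = {a, b, c}" and T': "T' \<in> triangles" "vertices T' = {a, b, d}"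
    and ne: "T \<noteq> T'" and d: "distinct [a, b, c]" "distinct [a, b, d]"
  shows "T \<inter> T' = closed_segment a b"
proof -
  have "c \<noteq> d"
    using ne hull_vertices[of T] hull_vertices[of T'] T T' by (auto simp: triangle_iff)
  then have "vertices T \<inter> vertices T' = {a, b}" using T(2) T'(2) d by auto
  then show ?thesis using Int_simplices[of T T'] T(1) T'(1) by (simp add: triangle_iff segment_convex_hull)
qed

text \<open>Each direction of the edge belongs to exactly one triangle, so the star lies in two
  triangles. Unfolded along the common edge they cover a planar neighbourhood of the parameter of
  \<open>x\<close>.\<close>

lemma interior_edge_point_not_boundary:
  assumes E: "(a, b) \<in> edges" "(b, a) \<in> edges" and x: "x \<in> open_segment a b"
  shows "x \<notin> surface_boundary M"
proof -
  obtain T c where T: "T \<in> triangles" "distinct [a, b, c]" "vertices T = {a, b, c}" "ori T = {(a, b), (b, c), (c, a)}"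
    using edge_triangle[OF E(1)] .
  obtain T' d where T': "T' \<in> triangles" "distinct [b, a, d]" "vertices T' = {b, a, d}" "ori T' = {(b, a), (a, d), (d, b)}"
    using edge_triangle[OF E(2)] .
  have v': "vertices T' = {a, b, d}" "distinct [a, b, d]" using T'(2,3) by auto
  note Tv = triangle_vertices[OF T(1,3)] and Tv' = triangle_vertices[OF T'(1) v'(1)]
  have "(b, a) \<notin> ori T" "(b, a) \<in> ori T'" using T(2,4) T'(4) by auto
  then have ne: "T \<noteq> T'" by blast
  have int: "T \<inter> T' = closed_segment a b"
    by (rule paired_edge_Int[OF T(1,3) T'(1) v'(1) ne T(2) v'(2)])
  have star: "star x \<subseteq> T \<union> T'"
  proof
    fix y assume "y \<in> star x"
    then obtain K where K: "K \<in> \<C>" "x \<in> K" "y \<in> K" by (rule star_simplex)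
    have "K = closed_segment a b \<or> (K \<in> triangles \<and> ((a, b) \<in> ori K \<or> (b, a) \<in> ori K))"
      using simplex_through_segment[OF edge_in_complex[OF E(1)] x K(1,2)] T(2)
      by (intro simplex_two_vertices_cases K(1)) simp_all
    then consider "K = closed_segment a b" | "K \<in> triangles" "(a, b) \<in> ori K" | "K \<in> triangles" "(b, a) \<in> ori K"
      by blast
    then show "y \<in> T \<union> T'"
    proof cases
      case 1 then show ?thesis using K(3) int by blast
    next
      case 2
      then have "K = T" using T(1,4) by (intro edge_unique_triangle[of K T "(a, b)"]) simp_all
      then show ?thesis using K(3) by simp
    next
      case 3
      then have "K = T'" using T'(1,4) by (intro edge_unique_triangle[of K T' "(b, a)"]) simp_all
      then show ?thesis using K(3) by simp
    qed
  qed
  let ?Q = "double_triangle_chart a b c d"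
  \<comment> \<open>The two halves overlap only where they should: a point of the lower half that
    lands in \<open>T\<close> lies on the common edge, hence has a real parameter. This reduces
    injectivity of the folded chart to the two triangle charts.\<close>
  have lower: "Im w = 0"
    if w: "w \<in> double_triangle" "Im w \<le> 0" "?Q w \<in> T" for w
  proof -
    have "cnj w \<in> standard_triangle" using w(1,2) by (simp add: double_triangle_def standard_triangle_def)
    then have "?Q w \<in> T'"
      using double_triangle_chart_lower[OF w(2)] triangle_chart_image[of a b d] Tv'(2) by (metis imageI)
    then have "?Q w \<in> closed_segment a b" using w(3) int by blast
    then obtain u where "?Q w = (1 - u) *\<^sub>R a + u *\<^sub>R b" by (auto simp: in_segment)
    then have "?Q w = triangle_chart a b d (of_real u)" by (simp add: triangle_chart_def algebra_simps)
    then have "triangle_chart a b d (cnj w) = triangle_chart a b d (of_real u)"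
      by (simp add: double_triangle_chart_lower[OF w(2)])
    then have "cnj w = of_real u" using inj_triangle_chart[OF Tv'(1) v'(2)] by (simp add: inj_eq)
    then have "Im (cnj w) = 0" by simp
    then show ?thesis by simp
  qed
  have upper: "?Q w \<in> T" if "w \<in> double_triangle" "Im w \<ge> 0" for w
  proof -
    have "w \<in> standard_triangle" using that by (simp add: double_triangle_def standard_triangle_def)
    then show ?thesis
      using double_triangle_chart_upper[OF that(2)] triangle_chart_image[of a b c] Tv(2) by (metis imageI)
  qed
  have inj: "inj_on ?Q double_triangle"
  proof -
    have both_upper: "w = w'" if "Im w \<ge> 0" "Im w' \<ge> 0" "?Q w = ?Q w'" for w w'
      using inj_triangle_chart[OF Tv(1) T(2)] that by (simp add: double_triangle_chart_upper inj_eq)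
    have both_lower: "w = w'" if "Im w \<le> 0" "Im w' \<le> 0" "?Q w = ?Q w'" for w w'
      using inj_triangle_chart[OF Tv'(1) v'(2)] that by (simp add: double_triangle_chart_lower inj_eq)
    have mixed: "w = w'" if "w \<in> double_triangle" "w' \<in> double_triangle" "Im w \<ge> 0" "Im w' \<le> 0" "?Q w = ?Q w'" for w w'
    proof -
      have "?Q w' \<in> T" using upper that by metis
      then have "Im w' = 0" using lower that by blast
      then show ?thesis using both_upper that by simp
    qed
    show ?thesis
    proof (rule inj_onI)
      fix w w' assume *: "w \<in> double_triangle" "w' \<in> double_triangle" "?Q w = ?Q w'"
      show "w = w'"
        using both_upper[of w w'] both_lower[of w w'] mixed[of w w'] mixed[of w' w] * by (metis linear)
    qed
  qed
  obtain u where u: "0 < u" "u < 1" "x = (1 - u) *\<^sub>R a + u *\<^sub>R b" using x by (auto simp: in_segment)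
  define z where "z = complex_of_real u"
  have xz: "x = ?Q z"
    using u(3) by (simp add: z_def double_triangle_chart_def algebra_simps)
  have "?Q z \<in> surface_boundary M \<longleftrightarrow> z \<notin> interior double_triangle"
  proof (rule surface_boundary_chart[OF compact_double_triangle continuous_on_double_triangle_chart inj])
    show "?Q ` double_triangle \<subseteq> M"
      unfolding double_triangle_chart_image Tv(2) Tv'(2) using Tv(3) Tv'(3) by blast
    show "z \<in> double_triangle" using u by (simp add: z_def double_triangle_def)
    show "star x \<subseteq> ?Q ` double_triangle"
      unfolding double_triangle_chart_image Tv(2) Tv'(2) by (rule star)
    have "x \<in> T" using x int by (auto simp: open_segment_def)
    then show "?Q z \<in> star x"
      unfolding xz[symmetric] using Tv(3) by (intro star_self) blast
  qed (rule openin_star)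
  moreover have "z \<in> interior double_triangle"
  proof (rule interiorI)
    show "open {z. 0 < Re z \<and> Re z + \<bar>Im z\<bar> < 1}"
      by (intro open_Collect_conj open_Collect_less continuous_intros)
  qed (use u in \<open>auto simp: z_def double_triangle_def\<close>)
  ultimately show ?thesis using xz by simp
qed

text \<open>\<open>x\<close> lies in the hull of the vertices that \<open>T\<close> shares with any
  simplex through \<open>x\<close>, but on no edge. So all three vertices are shared and the simplex
  is \<open>T\<close>.\<close>

lemma inner_triangle_point_not_boundary:
  assumes T: "T \<in> triangles" "x \<in> T"
    and ne: "\<And>a b. closed_segment a b \<in> \<C> \<Longrightarrow> x \<notin> closed_segment a b"
  shows "x \<notin> surface_boundary M"
proof -
  obtain a b c where d: "distinct [a, b, c]" and v: "vertices T = {a, b, c}"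
    using triangle_ori[OF T(1)] by metis
  note Tv = triangle_vertices[OF T(1) v]
  have ne': "x \<notin> closed_segment p q" if "p \<in> {a, b, c}" "q \<in> {a, b, c}" for p q
  proof (rule ne)
    show "closed_segment p q \<in> \<C>" unfolding segment_convex_hull
      using that v by (intro face_in_complex[OF Tv(4)]) auto
  qed
  have star: "star x \<subseteq> T"
  proof
    fix y assume "y \<in> star x"
    then obtain K where K: "K \<in> \<C>" "x \<in> K" "y \<in> K" by (rule star_simplex)
    have xh: "x \<in> convex hull ({a, b, c} \<inter> vertices K)"
      using Int_simplices[OF Tv(4) K(1)] K(2) T(2) v by auto
    have "\<not> {a, b, c} \<inter> vertices K \<subseteq> {p, q}" if "p \<in> {a, b, c}" "q \<in> {a, b, c}" for p q
    proof
      assume "{a, b, c} \<inter> vertices K \<subseteq> {p, q}"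
      then have "x \<in> convex hull {p, q}" using xh hull_mono by blast
      then show False using ne'[OF that] by (simp add: segment_convex_hull)
    qed
    from this[of a b] this[of b c] this[of a c] have "{a, b, c} \<subseteq> vertices K" by blast
    moreover have "card {a, b, c} = 3" using d by simp
    ultimately have "{a, b, c} = vertices K"
      using card_vertices_le_3[OF K(1)] finite_vertices[OF K(1)] by (intro card_seteq) simp_all
    then have "K = T" using hull_vertices[OF K(1)] Tv(2) by simp
    then show "y \<in> T" using K(3) by simp
  qed
  have "x \<in> triangle_chart a b c ` standard_triangle" using T(2) unfolding triangle_chart_image Tv(2) .
  then obtain z where z: "z \<in> standard_triangle" "x = triangle_chart a b c z" by blast
  have "triangle_chart a b c z \<in> surface_boundary M \<longleftrightarrow> z \<notin> interior standard_triangle"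
  proof (rule surface_boundary_chart[OF compact_standard_triangle continuous_on_triangle_chart])
    show "inj_on (triangle_chart a b c) standard_triangle"
      by (rule inj_on_subset[OF inj_triangle_chart[OF Tv(1) d]]) simp
    show "triangle_chart a b c ` standard_triangle \<subseteq> M"
      unfolding triangle_chart_image Tv(2) by (rule Tv(3))
    show "star x \<subseteq> triangle_chart a b c ` standard_triangle"
      unfolding triangle_chart_image Tv(2) by (rule star)
    show "triangle_chart a b c z \<in> star x"
      unfolding z(2)[symmetric] using T(2) Tv(3) by (intro star_self) blast
  qed (rule z openin_star)+
  moreover have "z \<in> interior standard_triangle"
  proof (rule interiorI)
    show "open {z. 0 < Re z \<and> 0 < Im z \<and> Re z + Im z < 1}"
      by (intro open_Collect_conj open_Collect_less continuous_intros)
    have "x \<in> closed_segment a c" if "Re z = 0"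
    proof -
      have "x = (1 - Im z) *\<^sub>R a + Im z *\<^sub>R c" using z(2) that by (simp add: triangle_chart_def algebra_simps)
      then show ?thesis using z(1) that unfolding in_segment by (auto simp: standard_triangle_def)
    qed
    moreover have "x \<in> closed_segment a b" if "Im z = 0"
    proof -
      have "x = (1 - Re z) *\<^sub>R a + Re z *\<^sub>R b" using z(2) that by (simp add: triangle_chart_def algebra_simps)
      then show ?thesis using z(1) that unfolding in_segment by (auto simp: standard_triangle_def)
    qed
    moreover have "x \<in> closed_segment b c" if "Re z + Im z = 1"
    proof -
      have *: "Re z = 1 - Im z" using that by simp
      have "x = (1 - Im z) *\<^sub>R b + Im z *\<^sub>R c" using z(2) unfolding triangle_chart_def *
        by (simp add: algebra_simps)
      then show ?thesis using z(1) that unfolding in_segment by (auto simp: standard_triangle_def)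
    qed
    ultimately have "Re z \<noteq> 0" "Im z \<noteq> 0" "Re z + Im z \<noteq> 1" using ne' by blast+
    then show "z \<in> {z. 0 < Re z \<and> 0 < Im z \<and> Re z + Im z < 1}"
      using z(1) by (auto simp: standard_triangle_def)
  qed (auto simp: standard_triangle_def)
  ultimately show ?thesis using z(2) by simp
qed

text \<open>Suppose that all edges are paired. An inner point of an edge has a triangle beside it by
  the dimension bound, hence one on either side, and a point on no edge is inside a triangle. Only
  vertices could then be boundary points; no charts are made at vertices, since there are finitely
  many of them and the boundary is infinite.\<close>

lemma unpaired_edge_exists:
  assumes "infinite (surface_boundary M)"
  shows "unpaired_edges \<noteq> {}"
proof
  assume "unpaired_edges = {}"
  then have paired: "(b, a) \<in> edges" if "(a, b) \<in> edges" for a b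
    using that unfolding unpaired_edges_def by blast
  have "(\<lambda>x. {x}) ` {x. {x} \<in> \<C>} \<subseteq> \<C>" by blast
  then have "finite ((\<lambda>x. {x}) ` {x. {x} \<in> \<C>})" by (rule finite_subset[OF _ finite_complex])
  then have "finite {x. {x} \<in> \<C>}" by (rule finite_imageD) (simp add: inj_on_def)
  then have "\<not> surface_boundary M \<subseteq> {x. {x} \<in> \<C>}" using assms finite_subset by blast
  then obtain x where x: "x \<in> surface_boundary M" "{x} \<notin> \<C>" by blast
  then have xM: "x \<in> M" by (simp add: surface_boundary_def)
  show False
  proof (cases "\<exists>a b. closed_segment a b \<in> \<C> \<and> x \<in> closed_segment a b")
    case True
    then obtain a b where ab: "closed_segment a b \<in> \<C>" "x \<in> closed_segment a b" by blast
    have "{a} \<in> \<C>" "{b} \<in> \<C>"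
      using face_in_complex[OF ab(1), of "{a}"] face_in_complex[OF ab(1), of "{b}"]
      by (simp_all add: vertices_segment)
    then have xo: "x \<in> open_segment a b" using ab(2) x(2) by (auto simp: open_segment_def)
    then have "a \<noteq> b" by auto
    have cases: "K = closed_segment a b \<or> (K \<in> triangles \<and> ((a, b) \<in> ori K \<or> (b, a) \<in> ori K))"
      if "K \<in> \<C>" "x \<in> K" for K
      using simplex_through_segment[OF ab(1) xo that] \<open>a \<noteq> b\<close>
      by (intro simplex_two_vertices_cases that(1))
    have "\<not> star x \<subseteq> closed_segment a b" by (rule star_not_subset_segment[OF xM])
    then obtain y where y: "y \<in> star x" "y \<notin> closed_segment a b" by blast
    obtain K where K: "K \<in> \<C>" "x \<in> K" "y \<in> K" using star_simplex[OF y(1)] .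
    have "(a, b) \<in> edges \<or> (b, a) \<in> edges"
      using cases[OF K(1,2)] K(3) y(2) unfolding edges_def by blast
    then have "(a, b) \<in> edges" "(b, a) \<in> edges" using paired by blast+
    then show False using interior_edge_point_not_boundary xo x(1) by blast
  next
    case False
    obtain K where K: "K \<in> \<C>" "x \<in> K" using xM Union by blast
    have "K \<in> triangles"
    proof (rule ccontr)
      assume "K \<notin> triangles"
      then have "card (vertices K) \<noteq> 3" using K(1) by (simp add: triangle_iff)
      then have "card (vertices K) \<le> 2" using card_vertices_le_3[OF K(1)] by simp
      moreover have "vertices K \<noteq> {}" using hull_vertices[OF K(1)] K(2) by force
      then have "card (vertices K) \<noteq> 0" using finite_vertices[OF K(1)] by simp
      ultimately have "card (vertices K) = 1 \<or> card (vertices K) = 2" by linarith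
      then obtain a b where "vertices K = {a, b}" by (auto simp: card_1_singleton_iff card_2_iff)
      then have "K = closed_segment a b" using hull_vertices[OF K(1)] by (simp add: segment_convex_hull)
      then show False using False K by blast
    qed
    then show False using inner_triangle_point_not_boundary K(2) False x(1) by blast
  qed
qed

section \<open>Vanishing of the period around the boundary\<close>

lemma segments_do_not_cross:
  assumes "closed_segment a b \<in> \<C>" "closed_segment p q \<in> \<C>" "{a, b} \<noteq> {p, q}" "a \<noteq> b"
  shows "closed_segment p q \<inter> open_segment a b = {}"
proof -
  have False if x: "x \<in> closed_segment p q" "x \<in> open_segment a b" for x
    using simplex_through_segment[OF assms(1) x(2) assms(2) x(1)] assms(3,4)
    by (auto simp: vertices_segment)
  then show ?thesis by blast
qed

lemma period_eq_0:
  fixes I :: "'a \<Rightarrow> 'a \<Rightarrow> complex" and \<gamma> :: "real \<Rightarrow> 'a"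
  assumes rs: "r < s" and cont: "continuous_on {r..s} \<gamma>" and closed: "\<gamma> r = \<gamma> s"
    and inj: "inj_on \<gamma> {r..<s}" and bd: "\<gamma> ` {r..s} = surface_boundary M"
    and I: "cocycle_on M I \<delta>" and \<Psi>: "primitive_along I {r..s} \<gamma> \<Psi>"
  shows "\<Psi> s = \<Psi> r"
proof -
  have "infinite (\<gamma> ` {r..<s})"
    using infinite_Ico[OF rs] inj by (simp add: finite_image_iff)
  moreover have "\<gamma> ` {r..<s} \<subseteq> surface_boundary M" unfolding bd[symmetric] by (intro image_mono) auto
  ultimately have "infinite (surface_boundary M)" using finite_subset by blast
  then obtain a b where ab: "(a, b) \<in> unpaired_edges" using unpaired_edge_exists by auto
  have sub_M: "surface_boundary M \<subseteq> M" by (auto simp: surface_boundary_def)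
  have "compact (surface_boundary M)" unfolding bd[symmetric] by (intro compact_continuous_image cont compact_Icc)
  then have cl: "closed (surface_boundary M)" by (rule compact_imp_closed)
  have unpaired: "p \<noteq> q" "(p, q) \<in> edges" "(q, p) \<notin> edges" "closed_segment p q \<subseteq> surface_boundary M"
    if pq: "(p, q) \<in> unpaired_edges" for p q
  proof -
    show E: "(p, q) \<in> edges" "(q, p) \<notin> edges" using pq by (auto simp: unpaired_edges_def)
    then show "p \<noteq> q" by blast
    \<comment> \<open>The charts treat inner points of the edge only; the endpoints follow because
      the boundary, being the image of \<open>\<gamma>\<close>, is closed.\<close>
    then have "closed_segment p q = closure (open_segment p q)" by (simp add: closure_open_segment)
    also have "\<dots> \<subseteq> surface_boundary M"
      using closure_minimal[OF unpaired_edge_subset_boundary[OF pq] cl] .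
    finally show "closed_segment p q \<subseteq> surface_boundary M" .
  qed
  obtain g k where k: "k = 1 \<or> k = -1" "segment_integral I a b = g b - g a + k * (\<Psi> s - \<Psi> r)"
    and g: "\<And>p q. closed_segment p q \<subseteq> surface_boundary M \<Longrightarrow> closed_segment p q \<inter> open_segment a b = {} \<Longrightarrow>
       segment_integral I p q = g q - g p"
    using segment_integral_on_closed_curve[OF rs cont closed inj _ I \<Psi> unpaired(1)[OF ab]] unpaired(4)[OF ab] sub_M
    unfolding bd by metis
  \<comment> \<open>At vertices off the curve \<open>g\<close> has arbitrary values. This is
    harmless, as the increments of any function cancel around each triangle.\<close>
  define K where "K p q = segment_integral I p q - (g q - g p)" for p q
  have "(\<Sum>(p, q)\<in>{(p, q) \<in> \<Union>(ori ` triangles). (q, p) \<notin> \<Union>(ori ` triangles)}. K p q) = 0"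
  proof (rule sum_unpaired_edges_eq_0[OF finite_triangles])
    fix T assume T: "T \<in> triangles"
    obtain x y z where xyz: "distinct [x, y, z]" "vertices T = {x, y, z}" "ori T = {(x, y), (y, z), (z, x)}"
      using triangle_ori[OF T] .
    note Tv = triangle_vertices[OF T xyz(2)]
    have "convex T" "compact T"
      unfolding Tv(2)[symmetric] by (rule convex_convex_hull, simp add: finite_imp_compact_convex_hull)
    then obtain P where "\<And>p q. p \<in> T \<Longrightarrow> q \<in> T \<Longrightarrow> segment_integral I p q = P q - P p"
      using segment_integral_in_convex[OF _ _ Tv(3) I] by metis
    moreover have "{x, y, z} \<subseteq> T" unfolding Tv(2)[symmetric] by (rule hull_subset)
    ultimately have "K x y + K y z + K z x = 0" by (simp add: K_def)
    then show "\<exists>a b c. distinct [a, b, c] \<and> ori T = {(a, b), (b, c), (c, a)} \<and> K a b + K b c + K c a = 0"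
      using xyz by blast
  next
    show "ori T \<inter> ori T' = {}" if "T \<in> triangles" "T' \<in> triangles" "T \<noteq> T'" for T T'
      using ori_disjoint that by (simp add: triangles_def)
  next
    fix p q assume "(p, q) \<in> \<Union>(ori ` triangles)"
    then have "closed_segment p q \<in> \<C>" unfolding edges_def[symmetric] by (rule edge_in_complex)
    then have "closed_segment p q \<subseteq> M" using Union by blast
    from segment_integral_flip[OF this I] show "K q p = - K p q" by (simp add: K_def)
  qed
  then have sum0: "(\<Sum>(p, q)\<in>unpaired_edges. K p q) = 0"
    unfolding unpaired_edges_def edges_def .
  have zero: "K p q = 0" if pq: "(p, q) \<in> unpaired_edges" "(p, q) \<noteq> (a, b)" for p q
  proof -
    \<comment> \<open>The reversed edge spans the same segment, which meets the cut, so it has to be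
      ruled out separately.\<close>
    have "(p, q) \<noteq> (b, a)" using unpaired(2)[OF pq(1)] unpaired(3)[OF ab] by blast
    then have "{a, b} \<noteq> {p, q}" using pq(2) by (auto simp: doubleton_eq_iff)
    then have "closed_segment p q \<inter> open_segment a b = {}"
      using unpaired(1,2)[OF ab] unpaired(2)[OF pq(1)] by (intro segments_do_not_cross edge_in_complex)
    then show ?thesis using g unpaired(4)[OF pq(1)] by (simp add: K_def)
  qed
  have "(\<Sum>e\<in>unpaired_edges. case_prod K e) = (\<Sum>e\<in>unpaired_edges. if e = (a, b) then K a b else 0)"
    using zero by (intro sum.cong) (auto split: if_splits)
  moreover have "finite unpaired_edges"
  proof (rule finite_subset)
    show "finite edges" unfolding edges_def
    proof (intro finite_UN_I finite_triangles)
      fix T assume "T \<in> triangles"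
      then obtain x y z where "ori T = {(x, y), (y, z), (z, x)}" using triangle_ori by metis
      then show "finite (ori T)" by simp
    qed
  qed (auto simp: unpaired_edges_def)
  ultimately have "K a b = 0" using sum0 ab by (simp add: sum.delta')
  then have "k * (\<Psi> s - \<Psi> r) = 0" using k(2) by (simp add: K_def)
  then show ?thesis using k(1) by auto
qed

end

section \<open>Integrals of locally exact forms along the boundary curve\<close>

lemma closed_curve_cont: "closed_curve r s \<Gamma> \<Longrightarrow> continuous_on {r..s} \<Gamma>"
  by (simp add: closed_curve_def piecewise_C1_differentiable_on_def)

lemma line_integral_over_boundary_eq_0:
  fixes \<omega> :: "bicomplex \<Rightarrow> bicomplex \<Rightarrow> complex"
  assumes S: "orientable_surface_bounded_by S r s \<Gamma>" and \<Gamma>: "closed_curve r s \<Gamma>"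
    and \<omega>: "locally_exact \<omega> S"
  shows "((\<lambda>t. \<omega> (\<Gamma> t) (vector_derivative \<Gamma> (at t within {r..s}))) has_integral 0) {r..s}"
proof (cases "r = s")
  case True
  \<comment> \<open>A constant curve on a one-point interval is settled directly;
    \<open>period_eq_0\<close> needs \<open>r < s\<close> to have infinitely many boundary
    points.\<close>
  then show ?thesis using has_integral_refl(2) by simp
next
  case False
  then have rs: "r < s" using \<Gamma> by (simp add: closed_curve_def)
  obtain M :: "bicomplex set" and h \<gamma> where M: "compact_surface M" "orientable_polyhedron M"
    and h: "continuous_on M h" "h ` M = S" and \<gamma>: "continuous_on {r..s} \<gamma>" "\<gamma> r = \<gamma> s" "inj_on \<gamma> {r..<s}"
      "\<gamma> ` {r..s} = surface_boundary M" "\<And>t. t \<in> {r..s} \<Longrightarrow> \<Gamma> t = h (\<gamma> t)"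
    using S unfolding orientable_surface_bounded_by_def by blast
  obtain \<C> ori where C: "simplicial_complex \<C>" "\<Union>\<C> = M"
    "\<forall>T\<in>\<C>. 2 simplex T \<longrightarrow> (\<exists>a b c. T = convex hull {a, b, c} \<and> ori T = {(a, b), (b, c), (c, a)})"
    "\<forall>T\<in>\<C>. \<forall>T'\<in>\<C>. 2 simplex T \<and> 2 simplex T' \<and> T \<noteq> T' \<longrightarrow> ori T \<inter> ori T' = {}"
    using M(2) unfolding orientable_polyhedron_def by (elim exE conjE) (rule that)
  interpret oriented_surface M \<C> ori
  proof
    show "\<exists>a b c. T = convex hull {a, b, c} \<and> ori T = {(a, b), (b, c), (c, a)}"
      if "T \<in> \<C>" "2 simplex T" for T
      by (rule C(3)[rule_format, OF that])
    show "ori T \<inter> ori T' = {}"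
      if "T \<in> \<C>" "T' \<in> \<C>" "2 simplex T" "2 simplex T'" "T \<noteq> T'" for T T'
      by (rule C(4)[rule_format, OF that(1,2)]) (simp add: that)
  qed (rule M(1) C(1,2))+
  have cM: "compact M" using M(1) by (simp add: compact_surface_def)
  obtain I \<delta> where I: "cocycle_on M I \<delta>"
    "\<And>x. x \<in> M \<Longrightarrow> \<exists>\<Phi>. (\<Phi> has_derivative \<omega> (h x)) (at (h x)) \<and>
        (\<forall>y\<in>M. dist x y < \<delta> \<longrightarrow> I x y = \<Phi> (h y) - \<Phi> (h x))"
    using locally_exact_cocycle[OF cM h(1), of \<omega>] \<omega> h(2) by blast
  have sub: "\<gamma> ` {r..s} \<subseteq> M" unfolding \<gamma>(4) by (auto simp: surface_boundary_def)
  obtain \<Psi> where \<Psi>: "primitive_along I {r..s} \<gamma> \<Psi>"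
    using primitive_along_exists[OF convex_real_interval(5) compact_Icc \<gamma>(1) sub I(1)] by blast
  have "\<Gamma> piecewise_C1_differentiable_on {r..s}" using \<Gamma> by (simp add: closed_curve_def)
  from primitive_along_has_integral[OF \<Psi> less_imp_le[OF rs] this \<gamma>(5,1) sub I]
  show ?thesis using period_eq_0[OF rs \<gamma>(1-4) I(1) \<Psi>] by simp
qed

text \<open>The parameter interval takes the place of the surface \<open>M\<close>, and
  \<open>\<Gamma>\<close> that of \<open>h\<close>. Existence matters because
  \<open>integral\<close> returns 0 for functions that are not integrable, so the integral of a sum
  can be split only once integrability is known.\<close>

lemma locally_exact_integrable_on:
  fixes \<omega> :: "bicomplex \<Rightarrow> bicomplex \<Rightarrow> complex"
  assumes \<Gamma>: "closed_curve r s \<Gamma>" and \<omega>: "locally_exact \<omega> (\<Gamma> ` {r..s})"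
  shows "(\<lambda>t. \<omega> (\<Gamma> t) (vector_derivative \<Gamma> (at t within {r..s}))) integrable_on {r..s}"
proof -
  obtain I \<delta> where I: "cocycle_on {r..s} I \<delta>"
    "\<And>x. x \<in> {r..s} \<Longrightarrow> \<exists>\<Phi>. (\<Phi> has_derivative \<omega> (\<Gamma> x)) (at (\<Gamma> x)) \<and>
        (\<forall>y\<in>{r..s}. dist x y < \<delta> \<longrightarrow> I x y = \<Phi> (\<Gamma> y) - \<Phi> (\<Gamma> x))"
    using locally_exact_cocycle[OF compact_Icc closed_curve_cont[OF \<Gamma>] \<omega>] by blast
  obtain \<Psi> where "primitive_along I {r..s} (\<lambda>t. t) \<Psi>"
    using primitive_along_exists[OF convex_real_interval(5) compact_Icc continuous_on_id _ I(1)] by auto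
  from primitive_along_has_integral[OF this _ _ _ continuous_on_id _ I]
  show ?thesis using \<Gamma> unfolding closed_curve_def by (auto intro: has_integral_integrable)
qed

section \<open>Bicomplex integrals from their coordinates\<close>

text \<open>The inverse of the isomorphism that takes \<open>p\<close> to the pair
  \<open>pr \<i> p\<close>, \<open>pr (-\<i>) p\<close>.\<close>

definition of_components :: "complex \<Rightarrow> complex \<Rightarrow> bicomplex" where
  "of_components x y = ((x + y)/2, (x - y)/(2*\<i>))"

lemma of_components_pr: "of_components (pr \<i> p) (pr (-\<i>) p) = p"
  by (simp add: of_components_def pr_def prod_eq_iff)

lemma has_integral_of_components:
  assumes "((\<lambda>t. pr \<i> (w t)) has_integral x) A" "((\<lambda>t. pr (-\<i>) (w t)) has_integral y) A"
  shows "(w has_integral of_components x y) A"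
proof -
  have b: "bounded_linear (\<lambda>z. (z / 2, z / (2*\<i>)))" "bounded_linear (\<lambda>z. (z / 2, - z / (2*\<i>)))"
    by (intro bounded_linear_Pair bounded_linear_divide bounded_linear_minus
        bounded_linear_compose[OF bounded_linear_divide] bounded_linear_ident)+
  have e: "(x / 2, x / (2*\<i>)) + (y / 2, - y / (2*\<i>)) = of_components x y" for x y
    by (simp add: of_components_def field_simps)
  show ?thesis
    using has_integral_add[OF has_integral_linear[OF assms(1) b(1)] has_integral_linear[OF assms(2) b(2)]]
    unfolding o_def e of_components_pr .
qed

lemma bic_times_left_commute: "p \<odot> (q \<odot> x) = q \<odot> (p \<odot> x)"
  by (simp add: bic_times_def algebra_simps)

lemma bounded_linear_bic_times: "bounded_linear ((\<odot>) p)"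
  unfolding bic_times_def
  by (intro bounded_linear_Pair bounded_linear_sub bounded_linear_add bounded_linear_const_mult
      bounded_linear_fst bounded_linear_snd)

theorem theorem5p6:
  fixes \<psi> :: "bicomplex \<Rightarrow> bicomplex" and p0 :: bicomplex
    and r s :: real and \<Gamma> :: "real \<Rightarrow> bicomplex" and G :: "bicomplex set"
  assumes "bic_domain G" and "closed_curve r s \<Gamma>"
    and a: "bic_holomorphic_on \<psi> G"
    and b: "\<Gamma> ` {r..s} \<subseteq> G" "\<forall>p\<in>\<Gamma> ` {r..s}. nonsingular (p - p0)"
    and c: "\<exists>S. S \<subseteq> G \<and> orientable_surface_bounded_by S r s \<Gamma> \<and>
          ((p0 \<notin> S \<and> twining_number r s \<Gamma> p0 = 0 \<and> (\<forall>p\<in>S. nonsingular (p - p0))) \<or>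
           (p0 \<in> S \<and> twining_number r s \<Gamma> p0 \<noteq> 0 \<and> (\<forall>p\<in>S - {p0}. nonsingular (p - p0))))"
  shows "\<psi> p0 \<odot> twining_number r s \<Gamma> p0 =
      (bic_of_real 1 \<oslash> (bic_of_real (2 * pi) \<odot> bic_j)) \<odot>
        bic_line_integral r s \<Gamma> (\<lambda>p. \<psi> p \<oslash> (p - p0))"
proof -
  define E where "E t = vector_derivative \<Gamma> (at t within {r..s})" for t
  define u where "u t = (\<psi> (\<Gamma> t) \<oslash> (\<Gamma> t - p0)) \<odot> E t" for t
  define v where "v t = (bic_of_real 1 \<oslash> (\<Gamma> t - p0)) \<odot> E t" for t
  have openG: "open G" using assms(1) by (simp add: bic_domain_def)
  have ii: "\<i>\<^sup>2 = -1" "(-\<i>)\<^sup>2 = -1" by simp_all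
  note \<Gamma> = assms(2)
  have der: "\<exists>D. ((\<lambda>q. pr k (\<psi> q)) has_derivative (\<lambda>d. D * pr k d)) (at q)"
    if "k\<^sup>2 = -1" "q \<in> G" for k q
    by (rule pr_holomorphic_has_derivative[OF that(1) a openG that(2)])
  have pr_u: "pr k (u t) = pr k (\<psi> (\<Gamma> t)) / (pr k (\<Gamma> t) - pr k p0) * pr k (E t)"
    and pr_v: "pr k (v t) = 1 / (pr k (\<Gamma> t) - pr k p0) * pr k (E t)"
    if k: "k\<^sup>2 = -1" and t: "t \<in> {r..s}" for k t
  proof -
    have "nonsingular (\<Gamma> t - p0)" using b(2) t by blast
    moreover have "pr k (bic_of_real 1) = 1" by (simp add: pr_def bic_of_real_def)
    ultimately show "pr k (u t) = pr k (\<psi> (\<Gamma> t)) / (pr k (\<Gamma> t) - pr k p0) * pr k (E t)"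
      "pr k (v t) = 1 / (pr k (\<Gamma> t) - pr k p0) * pr k (E t)"
      by (simp_all only: u_def v_def pr_times[OF k] pr_divide[OF k] pr_diff)
  qed
  obtain S where S: "S \<subseteq> G" "orientable_surface_bounded_by S r s \<Gamma>"
    and cases: "(twining_number r s \<Gamma> p0 = 0 \<and> (\<forall>p\<in>S. nonsingular (p - p0))) \<or>
           (p0 \<in> S \<and> (\<forall>p\<in>S - {p0}. nonsingular (p - p0)))"
    using c by blast
  show ?thesis
    using cases
  proof
    assume *: "twining_number r s \<Gamma> p0 = 0 \<and> (\<forall>p\<in>S. nonsingular (p - p0))"
    \<comment> \<open>The left side is zero by the value of the twining number. The right side is
      zero because the form of the full quotient has no singularity on \<open>S\<close>.\<close>
    have "((\<lambda>t. pr k (u t)) has_integral 0) {r..s}" if k: "k\<^sup>2 = -1" for k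
    proof -
      have "locally_exact (\<lambda>q d. (pr k (\<psi> q) - 0) / (pr k q - pr k p0) * pr k d) S"
      proof (rule locally_exact_quotient[OF k openG S(1) der[OF k]])
        show "pr k q \<noteq> pr k p0" if "q \<in> S" for q
          using * that pr_nonzero[OF k, of "q - p0"] by (auto simp: pr_diff)
      qed
      from line_integral_over_boundary_eq_0[OF S(2) \<Gamma> this] show ?thesis
        by (rule has_integral_eq[rotated]) (simp add: pr_u[OF k] E_def)
    qed
    from has_integral_of_components[OF this[OF ii(1)] this[OF ii(2)]]
    have "(u has_integral 0) {r..s}" by (simp add: of_components_def zero_prod_def)
    then have "bic_line_integral r s \<Gamma> (\<lambda>p. \<psi> p \<oslash> (p - p0)) = 0"
      unfolding bic_line_integral_def u_def E_def by (rule integral_unique)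
    then show ?thesis using * by (simp add: bic_times_def)
  next
    assume *: "p0 \<in> S \<and> (\<forall>p\<in>S - {p0}. nonsingular (p - p0))"
    have ne: "pr k (\<Gamma> t) \<noteq> pr k p0" if "k\<^sup>2 = -1" "t \<in> {r..s}" for k t
      using pr_nonzero[OF that(1), of "\<Gamma> t - p0"] b(2) that(2) by (auto simp: pr_diff)
    have int_v: "(\<lambda>t. pr k (v t)) integrable_on {r..s}" if k: "k\<^sup>2 = -1" for k
    proof -
      have "locally_exact (\<lambda>q d. (1 - 0) / (pr k q - pr k p0) * pr k d) (\<Gamma> ` {r..s})"
      proof (rule locally_exact_quotient[OF k open_UNIV subset_UNIV])
        show "\<exists>D. ((\<lambda>q. 1) has_derivative (\<lambda>d. D * pr k d)) (at q)" for q
          by (rule exI[of _ 0]) simp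
      qed (use ne[OF k] in blast)
      from locally_exact_integrable_on[OF \<Gamma> this] show ?thesis
        by (rule integrable_eq) (simp add: pr_v[OF k] E_def)
    qed
    \<comment> \<open>\<open>V\<close> is the twining number without the factor
      \<open>1 / (2 pi j)\<close>. Its existence allows the term with \<open>\<psi> p0\<close> to be
      added back at the end.\<close>
    obtain V where V: "(v has_integral V) {r..s}"
      using has_integral_of_components int_v[OF ii(1)] int_v[OF ii(2)] unfolding integrable_on_def by blast
    have pV: "((\<lambda>t. \<psi> p0 \<odot> v t) has_integral \<psi> p0 \<odot> V) {r..s}"
      using has_integral_linear[OF V bounded_linear_bic_times] by (simp add: o_def)
    \<comment> \<open>Subtracting \<open>\<psi> p0\<close> from the numerator removes the
      singularity: the difference quotient extends across \<open>p0\<close> to the function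
      \<open>F\<close>, whose form is locally exact on all of \<open>S\<close>. On the curve itself
      \<open>F\<close> is the plain quotient.\<close>
    have "((\<lambda>t. pr k (u t - \<psi> p0 \<odot> v t)) has_integral 0) {r..s}" if k: "k\<^sup>2 = -1" for k
    proof -
      have "pr k q \<noteq> pr k p0" if "q \<in> S - {p0}" for q
        using * that pr_nonzero[OF k, of "q - p0"] by (auto simp: pr_diff)
      then obtain F where F: "locally_exact (\<lambda>q d. F q * pr k d) S"
        "\<And>q. pr k q \<noteq> pr k p0 \<Longrightarrow> F q = (pr k (\<psi> q) - pr k (\<psi> p0)) / (pr k q - pr k p0)"
        using locally_exact_difference_quotient[OF k openG S(1) _ der[OF k], of p0] * S(1) by blast
      have "F (\<Gamma> t) * pr k (E t) = pr k (u t - \<psi> p0 \<odot> v t)" if t: "t \<in> {r..s}" for t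
        unfolding F(2)[OF ne[OF k t]] pr_diff pr_times[OF k] pr_u[OF k t] pr_v[OF k t]
        by (simp add: diff_divide_distrib left_diff_distrib)
      with line_integral_over_boundary_eq_0[OF S(2) \<Gamma> F(1)] show ?thesis
        unfolding E_def[symmetric] by (rule has_integral_eq[rotated])
    qed
    from has_integral_of_components[OF this[OF ii(1)] this[OF ii(2)]]
    have "((\<lambda>t. u t - \<psi> p0 \<odot> v t) has_integral 0) {r..s}" by (simp add: of_components_def zero_prod_def)
    from has_integral_add[OF this pV] have "(u has_integral \<psi> p0 \<odot> V) {r..s}" by simp
    then have "bic_line_integral r s \<Gamma> (\<lambda>p. \<psi> p \<oslash> (p - p0)) = \<psi> p0 \<odot> V"
      unfolding bic_line_integral_def u_def E_def by (rule integral_unique)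
    moreover have "bic_line_integral r s \<Gamma> (\<lambda>p. bic_of_real 1 \<oslash> (p - p0)) = V"
      using V unfolding bic_line_integral_def v_def E_def by (rule integral_unique)
    ultimately show ?thesis
      unfolding twining_number_def by (simp only: bic_times_left_commute[of "\<psi> p0"])
  qed
qed

end
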